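(* Let $(\boldsymbol{x},\boldsymbol{n},\boldsymbol{s}):U\to\mathbb{R}^3\times\Delta$ be a framed surface with basic invariants $a_i,b_i,e_i,f_i,g_i$ ($i=1,2$), and let $(u_0,v_0)\in U$. (1)(i) Suppose that $b_1g_2-b_2g_1=0$ on $U$, let $\theta^{s,n}:U\to\mathbb{R}$ be a smooth function, and let $$\lambda^{s,n}(u,v)=-\left(\int_{u_0}^{u}a_1(u,v)\,du+\int_{v_0}^{v}a_2(u_0,v)\,dv\right).$$ If we take $\lambda^{n,s}=-\lambda^{s,n}$ and $\theta^{n,s}=-\theta^{s,n}$, then $\mathcal{C}^{s}(\mathcal{I}^{s}(\boldsymbol{x},\boldsymbol{n},\boldsymbol{s}))=(\boldsymbol{x},\boldsymbol{n},\boldsymbol{s})$ (in particular, these functions satisfy the condition required to form $\mathcal{C}^s$ of $\mathcal{I}^{s}(\boldsymbol{x},\boldsymbol{n},\boldsymbol{s})$). (1)(ii) Suppose that $a_1g_2-a_2g_1=0$ on $U$, let $\theta^{t,n}:U\to\mathbb{R}$ be a smooth function, and let $$\lambda^{t,n}(u,v)=-\left(\int_{u_0}^{u}b_1(u,v)\,du+\int_{v_0}^{v}b_2(u_0,v)\,dv\right).$$ If we take $\lambda^{n,t}=-\lambda^{t,n}$ and $\theta^{n,t}=-\theta^{t,n}$, then $\mathcal{C}^{t}(\mathcal{I}^{t}(\boldsymbol{x},\boldsymbol{n},\boldsymbol{s}))=(\boldsymbol{x},\boldsymbol{n},\boldsymbol{s})$ (in particular, these functions satisfy the condition required to form $\mathcal{C}^t$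 of $\mathcal{I}^{t}(\boldsymbol{x},\boldsymbol{n},\boldsymbol{s})$). (2)(i) Suppose that there exist smooth functions $\lambda^{n,s},\theta^{n,s}:U\to\mathbb{R}$ such that for $i=1,2$, on $U$, $(a_i+\lambda^{n,s}e_i)\sin\theta^{n,s}+(b_i+\lambda^{n,s}f_i)\cos\theta^{n,s}=0$, and form $\mathcal{C}^{s}(\boldsymbol{x},\boldsymbol{n},\boldsymbol{s})$ with them. If we take $\theta^{s,n}=-\theta^{n,s}$, then $\mathcal{I}^{s}(\mathcal{C}^{s}(\boldsymbol{x},\boldsymbol{n},\boldsymbol{s}))=(\boldsymbol{x}+\lambda^{n,s}(u_0,v_0)\boldsymbol{n},\boldsymbol{n},\boldsymbol{s})$, where $\mathcal{I}^s$ is taken at the point $(u_0,v_0)$. (2)(ii) Suppose that there exist smooth functions $\lambda^{n,t},\theta^{n,t}:U\to\mathbb{R}$ such that for $i=1,2$, on $U$, $-(a_i+\lambda^{n,t}e_i)\cos\theta^{n,t}+(b_i+\lambda^{n,t}f_i)\sin\theta^{n,t}=0$, and form $\mathcal{C}^{t}(\boldsymbol{x},\boldsymbol{n},\boldsymbol{s})$ with them. If we take $\theta^{t,n}=-\theta^{n,t}$, then $\mathcal{I}^{t}(\mathcal{C}^{t}(\boldsymbol{x},\boldsymbol{n},\boldsymbol{s}))=(\boldsymbol{x}+\lambda^{n,t}(u_0,v_0)\boldsymbol{n},\boldsymbol{n},\boldsymbol{s})$, where $\mathcal{I}^t$ is taken at the point $(u_0,v_0)$.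
   Context: All maps are $C^\infty$. $U\subset\mathbb{R}^2$ is a simply connected domain with coordinates $(u,v)$, $S^2$ is the unit sphere in $\mathbb{R}^3$, and $\Delta=\{(\boldsymbol{a},\boldsymbol{b})\in S^2\times S^2 : \boldsymbol{a}\cdot\boldsymbol{b}=0\}$. A framed surface is a smooth map $(\boldsymbol{x},\boldsymbol{n},\boldsymbol{s}):U\to\mathbb{R}^3\times\Delta$ with $\boldsymbol{x}_u\cdot\boldsymbol{n}=\boldsymbol{x}_v\cdot\boldsymbol{n}=0$ on $U$. Put $\boldsymbol{t}=\boldsymbol{n}\times\boldsymbol{s}$. Its basic invariants are the smooth functions $a_i,b_i,e_i,f_i,g_i:U\to\mathbb{R}$ ($i=1,2$) determined by $\boldsymbol{x}_u=a_1\boldsymbol{s}+b_1\boldsymbol{t}$, $\boldsymbol{n}_u=e_1\boldsymbol{s}+f_1\boldsymbol{t}$, $\boldsymbol{s}_u=-e_1\boldsymbol{n}+g_1\boldsymbol{t}$, $\boldsymbol{t}_u=-f_1\boldsymbol{n}-g_1\boldsymbol{s}$, and the same equations with $\partial_v$ in place of $\partial_u$ and index $2$ in place of $1$. Integrability gives $(a_1)_v-(a_2)_u=b_1g_2-b_2g_1$ and $(b_1)_v-(b_2)_u=a_2g_1-a_1g_2$. The operations below send a framed surface (with the indicated auxiliary choices) to a framed surface; when an operation is applied to another framed surface, the invariants and frame vectors $\boldsymbol{n},\boldsymbol{s},\boldsymbol{t}$ in its definition are those of that framed surface. Caustics. $\mathcal{C}^{s}(\boldsymbol{x},\boldsymbol{n},\boldsymbol{s})=(\boldsymbol{x}+\lambda^{n,s}\boldsymbol{n},\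 \sin\theta^{n,s}\boldsymbol{s}+\cos\theta^{n,s}\boldsymbol{t},\ \boldsymbol{n})$, where $\lambda^{n,s},\theta^{n,s}:U\to\mathbb{R}$ are smooth functions satisfying $(a_i+\lambda^{n,s}e_i)\sin\theta^{n,s}+(b_i+\lambda^{n,s}f_i)\cos\theta^{n,s}=0$ on $U$ for $i=1,2$. $\mathcal{C}^{t}(\boldsymbol{x},\boldsymbol{n},\boldsymbol{s})=(\boldsymbol{x}+\lambda^{n,t}\boldsymbol{n},\ \cos\theta^{n,t}\boldsymbol{s}-\sin\theta^{n,t}\boldsymbol{t},\ \sin\theta^{n,t}\boldsymbol{s}+\cos\theta^{n,t}\boldsymbol{t})$, where $\lambda^{n,t},\theta^{n,t}:U\to\mathbb{R}$ are smooth functions satisfying $-(a_i+\lambda^{n,t}e_i)\cos\theta^{n,t}+(b_i+\lambda^{n,t}f_i)\sin\theta^{n,t}=0$ on $U$ for $i=1,2$. Involutes at $(u_0,v_0)\in U$. If $b_1g_2-b_2g_1=0$ on $U$, $\mathcal{I}^{s}(\boldsymbol{x},\boldsymbol{n},\boldsymbol{s})=(\boldsymbol{x}+\lambda^{s,n}\boldsymbol{s},\ \boldsymbol{s},\ \cos\theta^{s,n}\boldsymbol{t}-\sin\theta^{s,n}\boldsymbol{n})$, where $\theta^{s,n}:U\to\mathbb{R}$ is a smooth function and $\lambda^{s,n}(u,v)=-\left(\int_{u_0}^{u}a_1(u,v)\,du+\int_{v_0}^{v}a_2(u_0,v)\,dv\right)$. If $a_1g_2-a_2g_1=0$ on $U$,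 $\mathcal{I}^{t}(\boldsymbol{x},\boldsymbol{n},\boldsymbol{s})=(\boldsymbol{x}+\lambda^{t,n}\boldsymbol{t},\ \boldsymbol{t},\ \cos\theta^{t,n}\boldsymbol{n}-\sin\theta^{t,n}\boldsymbol{s})$, where $\theta^{t,n}:U\to\mathbb{R}$ is a smooth function and $\lambda^{t,n}(u,v)=-\left(\int_{u_0}^{u}b_1(u,v)\,du+\int_{v_0}^{v}b_2(u_0,v)\,dv\right)$. These integrals are integrals of the closed 1-forms $a_1du+a_2dv$, $b_1du+b_2dv$ along the path from $(u_0,v_0)$ to $(u_0,v)$ to $(u,v)$; if this path is not contained in $U$, they are read as integrals along any path in $U$ from $(u_0,v_0)$ to $(u,v)$. *)

theory Defs
  imports "HOL-Analysis.Analysis"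
begin

text \<open>
  Maps on an open set \<open>U\<close> of the \<open>(u,v)\<close>-plane are total functions on \<open>real \<times> real\<close>; only their
  values on \<open>U\<close> matter.
\<close>

text \<open>\<open>C\<^sup>k\<close> and \<open>C\<^sup>\<infinity>\<close> for maps between normed spaces of finite dimension; \<open>S\<close> is meant to be open.\<close>

primrec Ck_on :: "nat \<Rightarrow> 'a::real_normed_vector set \<Rightarrow> ('a \<Rightarrow> 'b::real_normed_vector) \<Rightarrow> bool" where
  "Ck_on 0 S f \<longleftrightarrow> continuous_on S f"
| "Ck_on (Suc k) S f \<longleftrightarrow>
     (\<forall>x\<in>S. f differentiable (at x)) \<and>
     (\<forall>h. Ck_on k S (\<lambda>x. frechet_derivative f (at x) h))"

definition smooth_on :: "'a::real_normed_vector set \<Rightarrow> ('a \<Rightarrow> 'b::real_normed_vector) \<Rightarrow> bool" where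
  "smooth_on S f \<longleftrightarrow> (\<forall>k. Ck_on k S f)"

definition du :: "(real \<times> real \<Rightarrow> 'b::real_normed_vector) \<Rightarrow> real \<times> real \<Rightarrow> 'b" where
  "du f p = vector_derivative (\<lambda>u. f (u, snd p)) (at (fst p))"

definition dv :: "(real \<times> real \<Rightarrow> 'b::real_normed_vector) \<Rightarrow> real \<times> real \<Rightarrow> 'b" where
  "dv f p = vector_derivative (\<lambda>v. f (fst p, v)) (at (snd p))"

definition Delta :: "((real^3) \<times> (real^3)) set" where
  "Delta = {(a, b). norm a = 1 \<and> norm b = 1 \<and> a \<bullet> b = 0}"

text \<open>A triple \<open>(x, n, s)\<close> of maps is one map into \<open>(real^3) \<times> (real^3) \<times> (real^3)\<close>.\<close>

type_synonym triple_map = "real \<times> real \<Rightarrow> (real^3) \<times> (real^3) \<times> (real^3)"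

definition xmap :: "triple_map \<Rightarrow> real \<times> real \<Rightarrow> real^3" where
  "xmap F p = fst (F p)"

definition nmap :: "triple_map \<Rightarrow> real \<times> real \<Rightarrow> real^3" where
  "nmap F p = fst (snd (F p))"

definition smap :: "triple_map \<Rightarrow> real \<times> real \<Rightarrow> real^3" where
  "smap F p = snd (snd (F p))"

definition tmap :: "triple_map \<Rightarrow> real \<times> real \<Rightarrow> real^3" where
  "tmap F p = cross3 (nmap F p) (smap F p)"

definition framed_surface :: "(real \<times> real) set \<Rightarrow> triple_map \<Rightarrow> bool" where
  "framed_surface U F \<longleftrightarrow>
     smooth_on U F \<and>
     (\<forall>p\<in>U. (nmap F p, smap F p) \<in> Delta \<and>
            du (xmap F) p \<bullet> nmap F p = 0 \<and> dv (xmap F) p \<bullet> nmap F p = 0)"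

record basic_inv =
  inv_a1 :: "real \<times> real \<Rightarrow> real"
  inv_b1 :: "real \<times> real \<Rightarrow> real"
  inv_e1 :: "real \<times> real \<Rightarrow> real"
  inv_f1 :: "real \<times> real \<Rightarrow> real"
  inv_g1 :: "real \<times> real \<Rightarrow> real"
  inv_a2 :: "real \<times> real \<Rightarrow> real"
  inv_b2 :: "real \<times> real \<Rightarrow> real"
  inv_e2 :: "real \<times> real \<Rightarrow> real"
  inv_f2 :: "real \<times> real \<Rightarrow> real"
  inv_g2 :: "real \<times> real \<Rightarrow> real"

text \<open>
  A relation rather than a function, because the equations determine the invariants only on \<open>U\<close>.
\<close>

definition basic_invariants :: "(real \<times> real) set \<Rightarrow> triple_map \<Rightarrow> basic_inv \<Rightarrow> bool" where
  "basic_invariants U F I \<longleftrightarrow>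
     smooth_on U (inv_a1 I) \<and> smooth_on U (inv_b1 I) \<and> smooth_on U (inv_e1 I) \<and>
     smooth_on U (inv_f1 I) \<and> smooth_on U (inv_g1 I) \<and>
     smooth_on U (inv_a2 I) \<and> smooth_on U (inv_b2 I) \<and> smooth_on U (inv_e2 I) \<and>
     smooth_on U (inv_f2 I) \<and> smooth_on U (inv_g2 I) \<and>
     (\<forall>p\<in>U.
        du (xmap F) p = inv_a1 I p *\<^sub>R smap F p + inv_b1 I p *\<^sub>R tmap F p \<and>
        du (nmap F) p = inv_e1 I p *\<^sub>R smap F p + inv_f1 I p *\<^sub>R tmap F p \<and>
        du (smap F) p = - inv_e1 I p *\<^sub>R nmap F p + inv_g1 I p *\<^sub>R tmap F p \<and>
        du (tmap F) p = - inv_f1 I p *\<^sub>R nmap F p - inv_g1 I p *\<^sub>R smap F p \<and>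
        dv (xmap F) p = inv_a2 I p *\<^sub>R smap F p + inv_b2 I p *\<^sub>R tmap F p \<and>
        dv (nmap F) p = inv_e2 I p *\<^sub>R smap F p + inv_f2 I p *\<^sub>R tmap F p \<and>
        dv (smap F) p = - inv_e2 I p *\<^sub>R nmap F p + inv_g2 I p *\<^sub>R tmap F p \<and>
        dv (tmap F) p = - inv_f2 I p *\<^sub>R nmap F p - inv_g2 I p *\<^sub>R smap F p)"

text \<open>
  The caustics and involutes come as a formula and a condition under which it is used; the condition
  is on the invariants \<open>I\<close> of the framed surface to which the operation is applied.
\<close>

definition caustic_s :: "(real \<times> real \<Rightarrow> real) \<Rightarrow> (real \<times> real \<Rightarrow> real) \<Rightarrow> triple_map \<Rightarrow> triple_map" where
  "caustic_s lam \<theta> F p =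
     (xmap F p + lam p *\<^sub>R nmap F p,
      sin (\<theta> p) *\<^sub>R smap F p + cos (\<theta> p) *\<^sub>R tmap F p,
      nmap F p)"

definition caustic_s_cond ::
  "(real \<times> real) set \<Rightarrow> basic_inv \<Rightarrow> (real \<times> real \<Rightarrow> real) \<Rightarrow> (real \<times> real \<Rightarrow> real) \<Rightarrow> bool" where
  "caustic_s_cond U I lam \<theta> \<longleftrightarrow>
     smooth_on U lam \<and> smooth_on U \<theta> \<and>
     (\<forall>p\<in>U.
        (inv_a1 I p + lam p * inv_e1 I p) * sin (\<theta> p) +
        (inv_b1 I p + lam p * inv_f1 I p) * cos (\<theta> p) = 0 \<and>
        (inv_a2 I p + lam p * inv_e2 I p) * sin (\<theta> p) +
        (inv_b2 I p + lam p * inv_f2 I p) * cos (\<theta> p) = 0)"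

definition caustic_t :: "(real \<times> real \<Rightarrow> real) \<Rightarrow> (real \<times> real \<Rightarrow> real) \<Rightarrow> triple_map \<Rightarrow> triple_map" where
  "caustic_t lam \<theta> F p =
     (xmap F p + lam p *\<^sub>R nmap F p,
      cos (\<theta> p) *\<^sub>R smap F p - sin (\<theta> p) *\<^sub>R tmap F p,
      sin (\<theta> p) *\<^sub>R smap F p + cos (\<theta> p) *\<^sub>R tmap F p)"

definition caustic_t_cond ::
  "(real \<times> real) set \<Rightarrow> basic_inv \<Rightarrow> (real \<times> real \<Rightarrow> real) \<Rightarrow> (real \<times> real \<Rightarrow> real) \<Rightarrow> bool" where
  "caustic_t_cond U I lam \<theta> \<longleftrightarrow>
     smooth_on U lam \<and> smooth_on U \<theta> \<and>
     (\<forall>p\<in>U.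
        - (inv_a1 I p + lam p * inv_e1 I p) * cos (\<theta> p) +
        (inv_b1 I p + lam p * inv_f1 I p) * sin (\<theta> p) = 0 \<and>
        - (inv_a2 I p + lam p * inv_e2 I p) * cos (\<theta> p) +
        (inv_b2 I p + lam p * inv_f2 I p) * sin (\<theta> p) = 0)"

definition involute_s :: "(real \<times> real \<Rightarrow> real) \<Rightarrow> (real \<times> real \<Rightarrow> real) \<Rightarrow> triple_map \<Rightarrow> triple_map" where
  "involute_s lam \<theta> F p =
     (xmap F p + lam p *\<^sub>R smap F p,
      smap F p,
      cos (\<theta> p) *\<^sub>R tmap F p - sin (\<theta> p) *\<^sub>R nmap F p)"

definition involute_s_cond :: "(real \<times> real) set \<Rightarrow> basic_inv \<Rightarrow> bool" where
  "involute_s_cond U I \<longleftrightarrow> (\<forall>p\<in>U. inv_b1 I p * inv_g2 I p - inv_b2 I p * inv_g1 I p = 0)"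

definition involute_t :: "(real \<times> real \<Rightarrow> real) \<Rightarrow> (real \<times> real \<Rightarrow> real) \<Rightarrow> triple_map \<Rightarrow> triple_map" where
  "involute_t lam \<theta> F p =
     (xmap F p + lam p *\<^sub>R tmap F p,
      tmap F p,
      cos (\<theta> p) *\<^sub>R nmap F p - sin (\<theta> p) *\<^sub>R smap F p)"

definition involute_t_cond :: "(real \<times> real) set \<Rightarrow> basic_inv \<Rightarrow> bool" where
  "involute_t_cond U I \<longleftrightarrow> (\<forall>p\<in>U. inv_a1 I p * inv_g2 I p - inv_a2 I p * inv_g1 I p = 0)"

text \<open>The integral of the 1-form \<open>P du + Q dv\<close> along a piecewise \<open>C\<^sup>1\<close> path.\<close>

definition line_integral ::
  "(real \<times> real \<Rightarrow> real) \<Rightarrow> (real \<times> real \<Rightarrow> real) \<Rightarrow> (real \<Rightarrow> real \<times> real) \<Rightarrow> real" where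
  "line_integral P Q c =
     integral {0..1} (\<lambda>\<tau>. P (c \<tau>) * fst (vector_derivative c (at \<tau>)) +
                          Q (c \<tau>) * snd (vector_derivative c (at \<tau>)))"

definition L_path :: "real \<times> real \<Rightarrow> real \<times> real \<Rightarrow> (real \<times> real) set" where
  "L_path p0 p = closed_segment p0 (fst p0, snd p) \<union> closed_segment (fst p0, snd p) p"

text \<open>
  A choice, for each point \<open>p\<close> of \<open>U\<close>, of a path in \<open>U\<close> from \<open>p0\<close> to \<open>p\<close>.
\<close>

definition path_choice ::
  "(real \<times> real) set \<Rightarrow> real \<times> real \<Rightarrow> (real \<times> real \<Rightarrow> real \<Rightarrow> real \<times> real) \<Rightarrow> bool" where
  "path_choice U p0 c \<longleftrightarrow>
     (\<forall>p\<in>U. valid_path (c p) \<and> path_image (c p) \<subseteq> U \<and>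
            pathstart (c p) = p0 \<and> pathfinish (c p) = p)"

lemma path_choice_exists:
  assumes "open U" "connected U" "p0 \<in> U"
  shows "\<exists>c. path_choice U p0 c"
proof -
  have "\<exists>g. valid_path g \<and> path_image g \<subseteq> U \<and> pathstart g = p0 \<and> pathfinish g = p"
    if "p \<in> U" for p
  proof -
    obtain g where g: "polynomial_function g" "path_image g \<subseteq> U" "pathstart g = p0" "pathfinish g = p"
      using connected_open_polynomial_connected[OF assms \<open>p \<in> U\<close>] by blast
    obtain g' where g': "polynomial_function g'" "\<And>t. (g has_vector_derivative g' t) (at t)"
      using has_vector_derivative_polynomial_function[OF g(1)] by blast
    then have "g C1_differentiable_on {0..1}"
      unfolding C1_differentiable_on_def using continuous_on_polymonial_function by blast
    then show ?thesis
      unfolding valid_path_def using C1_differentiable_imp_piecewise g by blast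
  qed
  then show ?thesis
    unfolding path_choice_def by metis
qed

text \<open>
  The integral of \<open>P du + Q dv\<close> from \<open>p0\<close> to \<open>p\<close>: first along \<open>u = fst p0\<close>, then along \<open>v = snd p\<close>,
  if this path stays in \<open>U\<close>, and otherwise along the path \<open>c p\<close>. As \<open>c\<close> is an arbitrary
  \<open>path_choice\<close>, a claim for all \<open>c\<close> is a claim for any path.
\<close>

definition form_integral ::
  "(real \<times> real) set \<Rightarrow> real \<times> real \<Rightarrow> (real \<times> real \<Rightarrow> real \<Rightarrow> real \<times> real) \<Rightarrow>
   (real \<times> real \<Rightarrow> real) \<Rightarrow> (real \<times> real \<Rightarrow> real) \<Rightarrow> real \<times> real \<Rightarrow> real" where
  "form_integral U p0 c P Q p =
     (if L_path p0 p \<subseteq> U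
      then (LBINT u=fst p0..fst p. P (u, snd p)) + (LBINT v=snd p0..snd p. Q (fst p0, v))
      else line_integral P Q (c p))"

definition involute_s_length ::
  "(real \<times> real) set \<Rightarrow> real \<times> real \<Rightarrow> (real \<times> real \<Rightarrow> real \<Rightarrow> real \<times> real) \<Rightarrow>
   basic_inv \<Rightarrow> real \<times> real \<Rightarrow> real" where
  "involute_s_length U p0 c I p = - form_integral U p0 c (inv_a1 I) (inv_a2 I) p"

definition involute_t_length ::
  "(real \<times> real) set \<Rightarrow> real \<times> real \<Rightarrow> (real \<times> real \<Rightarrow> real \<Rightarrow> real \<times> real) \<Rightarrow>
   basic_inv \<Rightarrow> real \<times> real \<Rightarrow> real" where
  "involute_t_length U p0 c I p = - form_integral U p0 c (inv_b1 I) (inv_b2 I) p"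

end

theory Submission
  imports Defs "HOL-Complex_Analysis.Riemann_Mapping"
begin

text \<open>
  Inserting the formulas of one operation into those of the other is a rotation by \<open>\<theta>\<close> followed by
  a rotation by \<open>-\<theta>\<close>, so the frames come back to the original one, and
  \<open>x\<close> comes back up to the sum of the two displacements along the same unit field. What has to be
  proved is therefore about the displacement \<open>\<lambda>\<close>, and it is the same in all four cases: which form is
  \<open>d\<lambda>\<close>, and is that form exact?

  For an involute, \<open>\<lambda>\<close> has to satisfy \<open>d\<lambda> = -(a\<^sub>1 du + a\<^sub>2 dv)\<close> (respectively with \<open>b\<close>); this removes the
  component of \<open>dx\<close> along the new normal and makes the new triple a framed surface. Symmetry of
  second derivatives gives the integrability conditions of a framed surface (\<open>integrability\<close>), by
  which the hypothesis \<open>b\<^sub>1 g\<^sub>2 - b\<^sub>2 g\<^sub>1 = 0\<close> (respectively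
  \<open>a\<^sub>1 g\<^sub>2 - a\<^sub>2 g\<^sub>1 = 0\<close>) says exactly that the form is closed. On a simply connected
  plane domain a closed form is exact (\<open>closed_form_potential\<close>), and the integral that defines \<open>\<lambda>\<close> is
  then a difference of values of a potential, whatever path is used (\<open>form_integral_exact\<close>).

  For a caustic the argument runs backwards: the component of the derivative of \<open>x + \<lambda> n\<close> along \<open>n\<close> is \<open>d\<lambda>\<close>, so the
  relevant invariants of the caustic are the partial derivatives of \<open>\<lambda>\<close>. They form a closed form,
  hence the caustic meets the hypothesis for its involute, and integrating \<open>d\<lambda>\<close> gives
  \<open>\<lambda> - \<lambda>(p\<^sub>0)\<close>, which leaves the parallel surface at signed distance \<open>\<lambda>(p\<^sub>0)\<close>.

  Exactness of a closed form is obtained from the Riemann mapping theorem: a biholomorphic map from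
  the plane or the disc onto the domain pulls the form back to a closed form on a convex set, where the radial
  integral is a potential, and the potential is transported back by the inverse map.
\<close>

section \<open>Smooth maps\<close>

lemma has_derivative_cong_open:
  assumes "open S" "x \<in> S" "\<And>y. y \<in> S \<Longrightarrow> f y = g y"
  shows "(f has_derivative D) (at x) \<longleftrightarrow> (g has_derivative D) (at x)"
  using assms by (metis has_derivative_transform_within_open)

lemma frechet_derivative_cong_open:
  assumes "open S" "x \<in> S" "\<And>y. y \<in> S \<Longrightarrow> f y = g y"
  shows "frechet_derivative f (at x) = frechet_derivative g (at x)"
  unfolding frechet_derivative_def using has_derivative_cong_open[OF assms] by simp

text \<open>
  \<^const>\<open>frechet_derivative\<close> picks a derivative of a total function, so replacing a function by
  another one that agrees with it on an open set has to be justified at every order.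
\<close>

lemma Ck_on_cong:
  assumes "open S" "\<And>x. x \<in> S \<Longrightarrow> f x = g x"
  shows "Ck_on k S f \<longleftrightarrow> Ck_on k S g"
  using assms(2)
proof (induction k arbitrary: f g)
  case 0
  then show ?case by (simp cong: continuous_on_cong)
next
  case (Suc k)
  have "f differentiable (at x) \<longleftrightarrow> g differentiable (at x)" if "x \<in> S" for x
    unfolding differentiable_def
    by (intro ex_cong1 has_derivative_cong_open[OF assms(1) that] Suc.prems)
  moreover have "Ck_on k S (\<lambda>x. frechet_derivative f (at x) h)
      \<longleftrightarrow> Ck_on k S (\<lambda>x. frechet_derivative g (at x) h)" for h
    by (rule Suc.IH) (simp add: frechet_derivative_cong_open[OF assms(1) _ Suc.prems])
  ultimately show ?case by simp
qed

text \<open>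
  The closure properties below are proved by differentiating by rule; this lets the derivative be
  any explicit formula that is valid on the open set.
\<close>

lemma Ck_on_SucI:
  assumes "open S" "\<And>x. x \<in> S \<Longrightarrow> (f has_derivative f' x) (at x)"
    and "\<And>h. Ck_on k S (\<lambda>x. f' x h)"
  shows "Ck_on (Suc k) S f"
proof -
  have "frechet_derivative f (at x) = f' x" if "x \<in> S" for x
    using frechet_derivative_at[OF assms(2)[OF that]] by simp
  then have "Ck_on k S (\<lambda>x. frechet_derivative f (at x) h)" for h
    by (intro Ck_on_cong[THEN iffD2, OF assms(1) _ assms(3)[of h]]) simp
  moreover have "f differentiable (at x)" if "x \<in> S" for x
    using assms(2)[OF that] unfolding differentiable_def by blast
  ultimately show ?thesis by simp
qed

lemma Ck_on_SucD:
  assumes "Ck_on (Suc k) S f" "x \<in> S"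
  shows "(f has_derivative frechet_derivative f (at x)) (at x)"
  using assms by (simp add: frechet_derivative_works)

lemma Ck_on_Suc_imp_Ck_on: "Ck_on (Suc k) S f \<Longrightarrow> Ck_on k S f"
proof (induction k arbitrary: f)
  case 0
  then show ?case
    by (simp add: continuous_at_imp_continuous_on differentiable_imp_continuous_within)
next
  case (Suc k)
  then show ?case by (subst Ck_on.simps(2), subst (asm) (2) Ck_on.simps(2)) blast
qed

lemma Ck_on_const: "open S \<Longrightarrow> Ck_on k S (\<lambda>x. c)"
  by (induction k arbitrary: c) auto

lemma Ck_on_add:
  assumes "open S" "Ck_on k S f" "Ck_on k S g"
  shows "Ck_on k S (\<lambda>x. f x + g x)"
  using assms(2,3)
proof (induction k arbitrary: f g)
  case (Suc k)
  show ?case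
    using Suc.prems Ck_on_SucD[OF Suc.prems(1)] Ck_on_SucD[OF Suc.prems(2)]
    by (intro Ck_on_SucI[OF assms(1) has_derivative_add] Suc.IH) auto
qed (simp add: continuous_on_add)

lemma Ck_on_bounded_linear:
  assumes "bounded_linear L" "open S" "Ck_on k S f"
  shows "Ck_on k S (\<lambda>x. L (f x))"
  using assms(3)
proof (induction k arbitrary: f)
  case 0
  then show ?case using assms(1) by (simp add: bounded_linear.continuous_on)
next
  case (Suc k)
  show ?case
    using Suc.prems
    by (intro Ck_on_SucI[OF assms(2) bounded_linear.has_derivative[OF assms(1) Ck_on_SucD[OF Suc.prems]]] Suc.IH) auto
qed

lemma Ck_on_bounded_bilinear:
  assumes "bounded_bilinear B" "open S" "Ck_on k S f" "Ck_on k S g"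
  shows "Ck_on k S (\<lambda>x. B (f x) (g x))"
  using assms(3,4)
proof (induction k arbitrary: f g)
  case 0
  then show ?case using assms(1) by (simp add: bounded_bilinear.continuous_on)
next
  case (Suc k)
  have "Ck_on k S (\<lambda>x. B (f x) (frechet_derivative g (at x) h) + B (frechet_derivative f (at x) h) (g x))" for h
    using Suc.prems Suc.prems[THEN Ck_on_Suc_imp_Ck_on]
    by (intro Ck_on_add[OF assms(2)] Suc.IH) auto
  then show ?case
    using bounded_bilinear.FDERIV[OF assms(1) Ck_on_SucD[OF Suc.prems(1)] Ck_on_SucD[OF Suc.prems(2)]]
    by (intro Ck_on_SucI[OF assms(2)])
qed

text \<open>
  Sine and cosine are treated together because each is the derivative of the other up to sign, so
  neither induction closes alone.
\<close>

lemma Ck_on_sin_cos: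
  fixes f :: "'a::real_normed_vector \<Rightarrow> real"
  assumes "open S" "Ck_on k S f"
  shows "Ck_on k S (\<lambda>x. sin (f x)) \<and> Ck_on k S (\<lambda>x. cos (f x))"
  using assms(2)
proof (induction k)
  case 0
  then show ?case by (auto intro!: continuous_intros)
next
  case (Suc k)
  note D = Ck_on_SucD[OF Suc.prems] and IH = Suc.IH[OF Ck_on_Suc_imp_Ck_on[OF Suc.prems]]
  have f': "Ck_on k S (\<lambda>x. frechet_derivative f (at x) h)" for h
    using Suc.prems by simp
  have s: "Ck_on k S (\<lambda>x. cos (f x) * frechet_derivative f (at x) h)" for h
    using IH f' by (intro Ck_on_bounded_bilinear[OF bounded_bilinear_mult assms(1)]) auto
  have c: "Ck_on k S (\<lambda>x. - (sin (f x) * frechet_derivative f (at x) h))" for h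
    using IH f' by (intro Ck_on_bounded_linear[OF bounded_linear_minus[OF bounded_linear_ident]]
        Ck_on_bounded_bilinear[OF bounded_bilinear_mult assms(1)] assms(1)) auto
  have "((\<lambda>x. sin (f x)) has_derivative (\<lambda>h. cos (f x) * frechet_derivative f (at x) h)) (at x)"
    "((\<lambda>x. cos (f x)) has_derivative (\<lambda>h. - (sin (f x) * frechet_derivative f (at x) h))) (at x)"
    if "x \<in> S" for x
    by (rule derivative_eq_intros D[OF that] refl | simp add: mult.commute)+
  note this(1)[THEN Ck_on_SucI[OF assms(1) _ s]] this(2)[THEN Ck_on_SucI[OF assms(1) _ c]]
  then show ?case by blast
qed

lemma smooth_on_cong:
  "open S \<Longrightarrow> (\<And>x. x \<in> S \<Longrightarrow> f x = g x) \<Longrightarrow> smooth_on S f \<longleftrightarrow> smooth_on S g"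
  unfolding smooth_on_def using Ck_on_cong by blast

named_theorems smooth_intros

lemma smooth_on_const [smooth_intros]: "open S \<Longrightarrow> smooth_on S (\<lambda>x. c)"
  by (simp add: smooth_on_def Ck_on_const)

lemma smooth_on_add [smooth_intros]:
  "open S \<Longrightarrow> smooth_on S f \<Longrightarrow> smooth_on S g \<Longrightarrow> smooth_on S (\<lambda>x. f x + g x)"
  by (simp add: smooth_on_def Ck_on_add)

lemma smooth_on_bounded_linear:
  "bounded_linear L \<Longrightarrow> open S \<Longrightarrow> smooth_on S f \<Longrightarrow> smooth_on S (\<lambda>x. L (f x))"
  by (simp add: smooth_on_def Ck_on_bounded_linear)

lemma smooth_on_bounded_bilinear:
  "bounded_bilinear B \<Longrightarrow> open S \<Longrightarrow> smooth_on S f \<Longrightarrow> smooth_on S g \<Longrightarrow> smooth_on S (\<lambda>x. B (f x) (g x))"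
  by (simp add: smooth_on_def Ck_on_bounded_bilinear)

lemmas smooth_on_minus [smooth_intros] =
  smooth_on_bounded_linear[OF bounded_linear_minus[OF bounded_linear_ident]]
lemmas smooth_on_fst [smooth_intros] = smooth_on_bounded_linear[OF bounded_linear_fst]
lemmas smooth_on_snd [smooth_intros] = smooth_on_bounded_linear[OF bounded_linear_snd]
lemmas smooth_on_scaleR [smooth_intros] = smooth_on_bounded_bilinear[OF bounded_bilinear_scaleR]
lemmas smooth_on_mult [smooth_intros] = smooth_on_bounded_bilinear[OF bounded_bilinear_mult]
lemmas smooth_on_inner [smooth_intros] = smooth_on_bounded_bilinear[OF bounded_bilinear_inner]

lemma bounded_bilinear_cross3: "bounded_bilinear cross3"
  using bilinear_cross bilinear_conv_bounded_bilinear by blast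

lemmas smooth_on_cross3 [smooth_intros] = smooth_on_bounded_bilinear[OF bounded_bilinear_cross3]

lemma smooth_on_diff [smooth_intros]:
  "open S \<Longrightarrow> smooth_on S f \<Longrightarrow> smooth_on S g \<Longrightarrow> smooth_on S (\<lambda>x. f x - g x)"
  using smooth_on_add[of S f "\<lambda>x. - g x"] by (simp add: smooth_on_minus)

lemma smooth_on_sin [smooth_intros]:
  "open S \<Longrightarrow> smooth_on S f \<Longrightarrow> smooth_on S (\<lambda>x. sin (f x :: real))"
  and smooth_on_cos [smooth_intros]:
  "open S \<Longrightarrow> smooth_on S f \<Longrightarrow> smooth_on S (\<lambda>x. cos (f x :: real))"
  by (simp_all add: smooth_on_def Ck_on_sin_cos)

lemma smooth_on_Pair [smooth_intros]:
  assumes "open S" "smooth_on S f" "smooth_on S g"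
  shows "smooth_on S (\<lambda>x. (f x, g x))"
proof -
  have "smooth_on S (\<lambda>x. (f x, 0) + (0, g x))"
    using assms by (intro smooth_on_add smooth_on_bounded_linear[of "\<lambda>y. (y, 0)"]
        smooth_on_bounded_linear[of "\<lambda>y. (0, y)"] bounded_linear_Pair bounded_linear_ident bounded_linear_zero)
  then show ?thesis by simp
qed

lemma smooth_on_imp_continuous_on: "smooth_on S f \<Longrightarrow> continuous_on S f"
  unfolding smooth_on_def using Ck_on.simps(1) by blast

lemma smooth_on_has_derivative:
  "smooth_on S f \<Longrightarrow> x \<in> S \<Longrightarrow> (f has_derivative frechet_derivative f (at x)) (at x)"
  unfolding smooth_on_def using Ck_on_SucD by blast

lemma smooth_on_frechet_derivative:
  "smooth_on S f \<Longrightarrow> smooth_on S (\<lambda>x. frechet_derivative f (at x) h)"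
  unfolding smooth_on_def using Ck_on.simps(2) by blast

text \<open>
  Integrals are known only through their derivatives; this is how their smoothness is obtained.
\<close>

lemma smooth_onI_derivative:
  assumes "open S" "\<And>x. x \<in> S \<Longrightarrow> (f has_derivative f' x) (at x)"
    and "\<And>h. smooth_on S (\<lambda>x. f' x h)"
  shows "smooth_on S f"
  unfolding smooth_on_def
proof
  fix k
  show "Ck_on k S f"
    using Ck_on_SucI[OF assms(1,2), of k] assms(3) Ck_on_Suc_imp_Ck_on
    unfolding smooth_on_def by blast
qed

lemma du_eqI: "(f has_derivative f') (at p) \<Longrightarrow> du f p = f' (1, 0)"
  and dv_eqI: "(f has_derivative f') (at p) \<Longrightarrow> dv f p = f' (0, 1)"
proof -
  assume f: "(f has_derivative f') (at p)"
  then interpret bounded_linear f'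
    by (rule has_derivative_bounded_linear)
  have f: "(f has_derivative f') (at (fst p, snd p))"
    using f by simp
  have "((\<lambda>u. f (u, snd p)) has_vector_derivative f' (1, 0)) (at (fst p))"
    unfolding has_vector_derivative_def scaleR[symmetric]
    by (rule has_derivative_compose[where f="\<lambda>u. (u, snd p)" and f'="\<lambda>d. d *\<^sub>R (1, 0)" and g=f and g'=f', OF _ f]) (auto intro!: derivative_eq_intros)
  then show "du f p = f' (1, 0)"
    unfolding du_def by (rule vector_derivative_at)
  have "((\<lambda>v. f (fst p, v)) has_vector_derivative f' (0, 1)) (at (snd p))"
    unfolding has_vector_derivative_def scaleR[symmetric]
    by (rule has_derivative_compose[where f="\<lambda>v. (fst p, v)" and f'="\<lambda>d. d *\<^sub>R (0, 1)" and g=f and g'=f', OF _ f]) (auto intro!: derivative_eq_intros)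
  then show "dv f p = f' (0, 1)"
    unfolding dv_def by (rule vector_derivative_at)
qed

lemma smooth_on_has_derivative_du_dv:
  assumes "smooth_on U f" "p \<in> U"
  shows "(f has_derivative (\<lambda>h. fst h *\<^sub>R du f p + snd h *\<^sub>R dv f p)) (at p)"
proof -
  note D = smooth_on_has_derivative[OF assms]
  interpret linear "frechet_derivative f (at p)"
    using D has_derivative_linear by blast
  have "frechet_derivative f (at p) h = fst h *\<^sub>R du f p + snd h *\<^sub>R dv f p" for h
  proof -
    have "h = fst h *\<^sub>R (1, 0) + snd h *\<^sub>R (0, 1)"
      by (simp add: prod_eq_iff)
    then show ?thesis
      unfolding du_eqI[OF D] dv_eqI[OF D] by (metis add scale)
  qed
  then have "frechet_derivative f (at p) = (\<lambda>h. fst h *\<^sub>R du f p + snd h *\<^sub>R dv f p)"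
    by (rule ext)
  with D show ?thesis by simp
qed

lemma smooth_on_du [smooth_intros]:
  assumes "open U" "smooth_on U f"
  shows "smooth_on U (du f)"
  using smooth_on_frechet_derivative[OF assms(2), of "(1, 0)"] assms(1)
  by (subst smooth_on_cong) (auto dest: du_eqI smooth_on_has_derivative[OF assms(2)])

lemma smooth_on_dv [smooth_intros]:
  assumes "open U" "smooth_on U f"
  shows "smooth_on U (dv f)"
  using smooth_on_frechet_derivative[OF assms(2), of "(0, 1)"] assms(1)
  by (subst smooth_on_cong) (auto dest: dv_eqI smooth_on_has_derivative[OF assms(2)])

section \<open>Symmetry of second derivatives\<close>

text \<open>
  The mean value theorem, applied first in the direction \<open>h\<close> and then in the direction \<open>k\<close>. The left-hand
  side of the equation is symmetric in \<open>h\<close> and \<open>k\<close>.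
\<close>

lemma second_difference_eq_mixed_derivative:
  fixes f :: "'a::real_normed_vector \<Rightarrow> real"
  assumes f: "\<And>x. x \<in> S \<Longrightarrow> (f has_derivative f' x) (at x)"
    and fh: "\<And>x. x \<in> S \<Longrightarrow> ((\<lambda>y. f' y h) has_derivative fh' x) (at x)"
    and "\<epsilon> > 0"
    and S: "\<And>s t. 0 \<le> s \<Longrightarrow> s \<le> \<epsilon> \<Longrightarrow> 0 \<le> t \<Longrightarrow> t \<le> \<epsilon> \<Longrightarrow> p + s *\<^sub>R h + t *\<^sub>R k \<in> S"
  obtains s t where "0 < s" "s < \<epsilon>" "0 < t" "t < \<epsilon>"
    "f (p + \<epsilon> *\<^sub>R h + \<epsilon> *\<^sub>R k) - f (p + \<epsilon> *\<^sub>R h) - f (p + \<epsilon> *\<^sub>R k) + f p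
       = \<epsilon> * \<epsilon> * fh' (p + s *\<^sub>R h + t *\<^sub>R k) k"
proof -
  define \<phi> where "\<phi> s = f (p + s *\<^sub>R h + \<epsilon> *\<^sub>R k) - f (p + s *\<^sub>R h)" for s
  have lin: "linear (f' x)" "linear (fh' x)" if "x \<in> S" for x
    using f[OF that] fh[OF that] has_derivative_linear by blast+
  have "(\<phi> has_real_derivative f' (p + s *\<^sub>R h + \<epsilon> *\<^sub>R k) h - f' (p + s *\<^sub>R h) h) (at s)"
    if "0 \<le> s" "s \<le> \<epsilon>" for s
  proof -
    have 1: "((\<lambda>s. f (p + s *\<^sub>R h + t *\<^sub>R k)) has_derivative (\<lambda>d. f' (p + s *\<^sub>R h + t *\<^sub>R k) (d *\<^sub>R h))) (at s)"
      if "t = 0 \<or> t = \<epsilon>" for t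
      using that \<open>0 \<le> s\<close> \<open>s \<le> \<epsilon>\<close> \<open>\<epsilon> > 0\<close>
      by (intro has_derivative_compose[OF _ f]) (auto intro!: derivative_eq_intros S)
    have "p + s *\<^sub>R h + \<epsilon> *\<^sub>R k \<in> S" "p + s *\<^sub>R h \<in> S"
      using S[of s \<epsilon>] S[of s 0] that \<open>\<epsilon> > 0\<close> by auto
    then show ?thesis
      using has_derivative_diff[OF 1[of \<epsilon>] 1[of 0]]
      unfolding \<phi>_def has_field_derivative_def
      by (simp add: linear_cmul[OF lin(1)] right_diff_distrib[symmetric] mult_commute_abs)
  qed
  then obtain s where s: "0 < s" "s < \<epsilon>"
    "\<phi> \<epsilon> - \<phi> 0 = (\<epsilon> - 0) * (f' (p + s *\<^sub>R h + \<epsilon> *\<^sub>R k) h - f' (p + s *\<^sub>R h) h)"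
    using MVT2[of 0 \<epsilon> \<phi> "\<lambda>s. f' (p + s *\<^sub>R h + \<epsilon> *\<^sub>R k) h - f' (p + s *\<^sub>R h) h"] \<open>\<epsilon> > 0\<close> by blast
  have "((\<lambda>t. f' (p + s *\<^sub>R h + t *\<^sub>R k) h) has_real_derivative fh' (p + s *\<^sub>R h + t *\<^sub>R k) k) (at t)"
    if "0 \<le> t" "t \<le> \<epsilon>" for t
  proof -
    have x: "p + s *\<^sub>R h + t *\<^sub>R k \<in> S" using S[of s t] s that by simp
    have "((\<lambda>t. f' (p + s *\<^sub>R h + t *\<^sub>R k) h) has_derivative (\<lambda>d. fh' (p + s *\<^sub>R h + t *\<^sub>R k) (d *\<^sub>R k))) (at t)"
      by (rule has_derivative_compose[where g="\<lambda>y. f' y h" and f="\<lambda>t. p + s *\<^sub>R h + t *\<^sub>R k" and f'="\<lambda>d. d *\<^sub>R k",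
            OF _ fh[OF x]]) (auto intro!: derivative_eq_intros)
    then show ?thesis
      unfolding has_field_derivative_def using linear_cmul[OF lin(2)[OF x]] by (simp add: mult_commute_abs)
  qed
  then obtain t where t: "0 < t" "t < \<epsilon>"
    "f' (p + s *\<^sub>R h + \<epsilon> *\<^sub>R k) h - f' (p + s *\<^sub>R h + 0 *\<^sub>R k) h = (\<epsilon> - 0) * fh' (p + s *\<^sub>R h + t *\<^sub>R k) k"
    using MVT2[of 0 \<epsilon> "\<lambda>t. f' (p + s *\<^sub>R h + t *\<^sub>R k) h" "\<lambda>t. fh' (p + s *\<^sub>R h + t *\<^sub>R k) k"] \<open>\<epsilon> > 0\<close> by blast
  show thesis
    using that[OF s(1,2) t(1,2)] s(3) t(3) by (simp add: \<phi>_def)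
qed

text \<open>
  Schwarz's theorem: by the preceding lemma and its mirror image, the same second difference is
  a value of each mixed derivative at a point near \<open>p\<close>, and continuity lets that point tend to \<open>p\<close>.
\<close>

lemma symmetric_second_derivative:
  fixes f :: "'a::real_normed_vector \<Rightarrow> real"
  assumes "open S" "p \<in> S"
    and f: "\<And>x. x \<in> S \<Longrightarrow> (f has_derivative f' x) (at x)"
    and fh: "\<And>x. x \<in> S \<Longrightarrow> ((\<lambda>y. f' y h) has_derivative fh' x) (at x)"
    and fk: "\<And>x. x \<in> S \<Longrightarrow> ((\<lambda>y. f' y k) has_derivative fk' x) (at x)"
    and cont: "continuous_on S (\<lambda>x. fh' x k)" "continuous_on S (\<lambda>x. fk' x h)"
  shows "fh' p k = fk' p h"
proof -
  have "\<bar>fh' p k - fk' p h\<bar> \<le> e" if "e > 0" for e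
  proof -
    have "(\<lambda>x. fh' x k) \<midarrow>p\<rightarrow> fh' p k" "(\<lambda>x. fk' x h) \<midarrow>p\<rightarrow> fk' p h"
      using cont assms(1,2) by (auto simp: continuous_on_eq_continuous_at isCont_def)
    note this[THEN tendsto_at_iff_tendsto_nhds[THEN iffD1], THEN tendstoD, of "e/2"]
    then have "\<forall>\<^sub>F x in nhds p. dist (fh' x k) (fh' p k) < e/2" "\<forall>\<^sub>F x in nhds p. dist (fk' x h) (fk' p h) < e/2"
      using \<open>e > 0\<close> by simp_all
    moreover have "\<forall>\<^sub>F x in nhds p. x \<in> S"
      using assms(1,2) by (rule eventually_nhds_in_open)
    ultimately have "\<forall>\<^sub>F x in nhds p. x \<in> S \<and> dist (fh' x k) (fh' p k) < e/2 \<and> dist (fk' x h) (fk' p h) < e/2"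
      by eventually_elim auto
    then obtain d where "d > 0" and d: "\<And>x. dist x p < d \<Longrightarrow>
        x \<in> S \<and> dist (fh' x k) (fh' p k) < e/2 \<and> dist (fk' x h) (fk' p h) < e/2"
      unfolding eventually_nhds_metric by blast
    \<comment> \<open>The summand 1 keeps \<open>c\<close> positive when both directions vanish; \<open>\<epsilon>\<close> is chosen so that the
      parallelogram with sides \<open>\<epsilon> *\<^sub>R h\<close> and \<open>\<epsilon> *\<^sub>R k\<close> stays within distance \<open>d/2\<close> of \<open>p\<close>.\<close>
    define c where "c = norm h + norm k + 1"
    define \<epsilon> where "\<epsilon> = d / (2 * c)"
    have "c > 0" by (simp add: c_def add_nonneg_pos)
    then have "\<epsilon> > 0" using \<open>d > 0\<close> by (simp add: \<epsilon>_def)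
    have near: "dist (p + s *\<^sub>R h + t *\<^sub>R k) p < d" "dist (p + t *\<^sub>R k + s *\<^sub>R h) p < d"
      if "0 \<le> s" "s \<le> \<epsilon>" "0 \<le> t" "t \<le> \<epsilon>" for s t
    proof -
      have "norm (s *\<^sub>R h + t *\<^sub>R k) \<le> s * norm h + t * norm k"
        using that norm_triangle_ineq[of "s *\<^sub>R h" "t *\<^sub>R k"] by simp
      also have "\<dots> \<le> \<epsilon> * norm h + \<epsilon> * norm k"
        using that by (intro add_mono mult_right_mono) auto
      also have "\<dots> \<le> \<epsilon> * c"
        using \<open>\<epsilon> > 0\<close> by (simp add: c_def algebra_simps)
      also have "\<dots> < d"
        using \<open>d > 0\<close> \<open>c > 0\<close> by (simp add: \<epsilon>_def)
      finally show "dist (p + s *\<^sub>R h + t *\<^sub>R k) p < d" "dist (p + t *\<^sub>R k + s *\<^sub>R h) p < d"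
        by (simp_all add: dist_norm algebra_simps)
    qed
    have "p + s *\<^sub>R h + t *\<^sub>R k \<in> S" "p + s *\<^sub>R k + t *\<^sub>R h \<in> S"
      if "0 \<le> s" "s \<le> \<epsilon>" "0 \<le> t" "t \<le> \<epsilon>" for s t
      using d near(1)[OF that] near(2)[OF that(3,4,1,2)] by blast+
    note diff = second_difference_eq_mixed_derivative[OF f fh \<open>\<epsilon> > 0\<close> this(1)]
      second_difference_eq_mixed_derivative[OF f fk \<open>\<epsilon> > 0\<close> this(2)]
    obtain s t where st: "0 < s" "s < \<epsilon>" "0 < t" "t < \<epsilon>"
      "f (p + \<epsilon> *\<^sub>R h + \<epsilon> *\<^sub>R k) - f (p + \<epsilon> *\<^sub>R h) - f (p + \<epsilon> *\<^sub>R k) + f p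
         = \<epsilon> * \<epsilon> * fh' (p + s *\<^sub>R h + t *\<^sub>R k) k"
      using diff(1) by blast
    obtain s' t' where st': "0 < t'" "t' < \<epsilon>" "0 < s'" "s' < \<epsilon>"
      "f (p + \<epsilon> *\<^sub>R k + \<epsilon> *\<^sub>R h) - f (p + \<epsilon> *\<^sub>R k) - f (p + \<epsilon> *\<^sub>R h) + f p
         = \<epsilon> * \<epsilon> * fk' (p + t' *\<^sub>R k + s' *\<^sub>R h) h"
      using diff(2) by blast
    have swap: "p + \<epsilon> *\<^sub>R k + \<epsilon> *\<^sub>R h = p + \<epsilon> *\<^sub>R h + \<epsilon> *\<^sub>R k"
      by (simp add: algebra_simps)
    have "\<epsilon> * \<epsilon> * fh' (p + s *\<^sub>R h + t *\<^sub>R k) k = \<epsilon> * \<epsilon> * fk' (p + t' *\<^sub>R k + s' *\<^sub>R h) h"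
      using st(5) st'(5) unfolding swap by linarith
    then have "fh' (p + s *\<^sub>R h + t *\<^sub>R k) k = fk' (p + t' *\<^sub>R k + s' *\<^sub>R h) h"
      using \<open>\<epsilon> > 0\<close> by simp
    then show ?thesis
      using d[OF near(1), of s t] d[OF near(2), of s' t'] st(1-4) st'(1-4)
      unfolding dist_real_def by linarith
  qed
  then show ?thesis
    using field_le_epsilon[of "\<bar>fh' p k - fk' p h\<bar>" 0] by simp
qed

lemma dv_du_eq_du_dv:
  fixes f :: "real \<times> real \<Rightarrow> 'b::real_inner"
  assumes "open U" "smooth_on U f" "p \<in> U"
  shows "dv (du f) p = du (dv f) p"
proof -
  have "dv (du f) p \<bullet> w = du (dv f) p \<bullet> w" for w
  proof -
    have D: "((\<lambda>x. f x \<bullet> w) has_derivative (\<lambda>h. (fst h *\<^sub>R du f x + snd h *\<^sub>R dv f x) \<bullet> w)) (at x)"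
      "((\<lambda>x. du f x \<bullet> w) has_derivative (\<lambda>h. (fst h *\<^sub>R du (du f) x + snd h *\<^sub>R dv (du f) x) \<bullet> w)) (at x)"
      "((\<lambda>x. dv f x \<bullet> w) has_derivative (\<lambda>h. (fst h *\<^sub>R du (dv f) x + snd h *\<^sub>R dv (dv f) x) \<bullet> w)) (at x)"
      if "x \<in> U" for x
      using that assms(1,2)
      by (auto intro!: bounded_linear.has_derivative[OF bounded_linear_inner_left] smooth_on_has_derivative_du_dv smooth_intros)
    have "smooth_on U (\<lambda>x. dv (du f) x \<bullet> w)" "smooth_on U (\<lambda>x. du (dv f) x \<bullet> w)"
      using assms(1,2) by (intro smooth_intros; simp)+
    note this[THEN smooth_on_imp_continuous_on]
    then show ?thesis
      using symmetric_second_derivative[OF assms(1,3) D(1), where h="(1,0)" and k="(0,1)"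
          and fh'="\<lambda>x h. (fst h *\<^sub>R du (du f) x + snd h *\<^sub>R dv (du f) x) \<bullet> w"
          and fk'="\<lambda>x h. (fst h *\<^sub>R du (dv f) x + snd h *\<^sub>R dv (dv f) x) \<bullet> w"] D(2,3)
      by simp
  qed
  then show ?thesis
    by (metis vector_eq_ldot inner_commute)
qed

section \<open>Closed forms on simply connected plane domains\<close>

text \<open>
  Pointwise continuity of a family of linear maps is joint continuity in finite dimension: expand
  the argument in a basis.
\<close>

lemma continuous_on_apply_linear:
  fixes L :: "'t::topological_space \<Rightarrow> 'a::euclidean_space \<Rightarrow> 'b::real_normed_vector"
  assumes lin: "\<And>x. x \<in> T \<Longrightarrow> linear (L x)"
    and L: "\<And>h. continuous_on T (\<lambda>x. L x h)"
    and w: "continuous_on T w"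
  shows "continuous_on T (\<lambda>x. L x (w x))"
proof -
  have "L x (w x) = (\<Sum>b\<in>Basis. (w x \<bullet> b) *\<^sub>R L x b)" if "x \<in> T" for x
  proof -
    have "L x (w x) = L x (\<Sum>b\<in>Basis. (w x \<bullet> b) *\<^sub>R b)"
      by (simp add: euclidean_representation)
    also have "\<dots> = (\<Sum>b\<in>Basis. (w x \<bullet> b) *\<^sub>R L x b)"
      using lin[OF that] by (simp add: linear_sum linear_cmul)
    finally show ?thesis .
  qed
  then show ?thesis
    by (subst continuous_on_cong[OF refl]) (auto intro!: continuous_intros L w)
qed

text \<open>
  The 1-form \<open>h \<mapsto> g x \<bullet> h\<close> is represented by the vector field \<open>g\<close>, and it is closed when the derivative
  of \<open>g\<close> is a symmetric bilinear form. The potential is the integral of the form along the segment from a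
  base point \<open>a\<close>. Differentiating under the integral, symmetry turns the integrand into the derivative of
  \<open>t *\<^sub>R g (a + t *\<^sub>R (x - a))\<close>, whose integral over the unit interval is \<open>g x\<close>.
\<close>

lemma poincare_convex:
  fixes g :: "'a::euclidean_space \<Rightarrow> 'a"
  assumes "open S" "convex S"
    and g: "\<And>x. x \<in> S \<Longrightarrow> (g has_derivative g' x) (at x)"
    and sym: "\<And>x h k. x \<in> S \<Longrightarrow> g' x h \<bullet> k = g' x k \<bullet> h"
    and cont: "\<And>h. continuous_on S (\<lambda>x. g' x h)"
  shows "\<exists>f. \<forall>x\<in>S. (f has_derivative (\<lambda>h. g x \<bullet> h)) (at x)"
proof (cases "S = {}")
  case False
  then obtain a where "a \<in> S" by blast
  define \<gamma> where "\<gamma> x t = a + t *\<^sub>R (x - a)" for x and t :: real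
  \<comment> \<open>The gradient with respect to \<open>x\<close> of the integrand of \<open>f\<close>, after the use of symmetry.\<close>
  define w where "w x t = t *\<^sub>R g' (\<gamma> x t) (x - a) + g (\<gamma> x t)" for x t
  define f where "f x = integral (cbox 0 1) (\<lambda>t. g (\<gamma> x t) \<bullet> (x - a))" for x
  have \<gamma>: "\<gamma> x t \<in> S" if "x \<in> S" "t \<in> {0..1}" for x t
  proof -
    have "\<gamma> x t = (1 - t) *\<^sub>R a + t *\<^sub>R x" by (simp add: \<gamma>_def algebra_simps)
    then show ?thesis using convexD_alt[OF assms(2) \<open>a \<in> S\<close>, of x t] that by simp
  qed
  have lin: "linear (g' x)" if "x \<in> S" for x
    using g[OF that] has_derivative_linear by blast
  have contg: "continuous_on S g"
    using g assms(1) by (auto simp: continuous_on_eq_continuous_at intro: has_derivative_continuous)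
  have cont\<gamma>: "continuous_on (S \<times> {0..1}) (\<lambda>p. \<gamma> (fst p) (snd p))"
    unfolding \<gamma>_def by (intro continuous_intros)
  have contw: "continuous_on (S \<times> {0..1}) (\<lambda>(x, t). w x t)"
  proof -
    have "continuous_on (S \<times> {0..1}) (\<lambda>p. g (\<gamma> (fst p) (snd p)))"
      using \<gamma> by (intro continuous_on_compose2[OF contg cont\<gamma>]) auto
    moreover have "continuous_on (S \<times> {0..1}) (\<lambda>p. g' (\<gamma> (fst p) (snd p)) h)" for h
      using \<gamma> by (intro continuous_on_compose2[OF cont cont\<gamma>]) auto
    then have "continuous_on (S \<times> {0..1}) (\<lambda>p. g' (\<gamma> (fst p) (snd p)) (fst p - a))"
      using \<gamma> lin
      by (rule_tac continuous_on_apply_linear[where L="\<lambda>p. g' (\<gamma> (fst p) (snd p))"])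
        (auto intro!: continuous_intros)
    ultimately show ?thesis
      unfolding w_def split_beta by (intro continuous_intros)
  qed
  have D\<gamma>: "((\<lambda>x. g (\<gamma> x t) \<bullet> (x - a)) has_derivative blinfun_inner_right (w x t)) (at x within S)"
    if "x \<in> S" "t \<in> {0..1}" for x t
  proof -
    have y: "\<gamma> x t \<in> S" using \<gamma> that by blast
    have "((\<lambda>x. g (\<gamma> x t)) has_derivative (\<lambda>h. g' (\<gamma> x t) (t *\<^sub>R h))) (at x within S)"
      by (rule has_derivative_compose[where f="\<lambda>x. \<gamma> x t" and g=g, OF _ g[OF y]])
        (auto simp: \<gamma>_def intro!: derivative_eq_intros)
    moreover have "((\<lambda>x. x - a) has_derivative (\<lambda>h. h)) (at x within S)"
      by (auto intro!: derivative_eq_intros)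
    ultimately have "((\<lambda>x. g (\<gamma> x t) \<bullet> (x - a)) has_derivative
        (\<lambda>h. g (\<gamma> x t) \<bullet> h + g' (\<gamma> x t) (t *\<^sub>R h) \<bullet> (x - a))) (at x within S)"
      by (rule has_derivative_inner)
    also have "(\<lambda>h. g (\<gamma> x t) \<bullet> h + g' (\<gamma> x t) (t *\<^sub>R h) \<bullet> (x - a)) = blinfun_inner_right (w x t)"
      using sym[OF y, of _ "x - a"]
      by (simp add: w_def inner_add_left linear_cmul[OF lin[OF y]] fun_eq_iff)
    finally show ?thesis .
  qed
  have "(f has_derivative (\<lambda>h. g x \<bullet> h)) (at x)" if "x \<in> S" for x
  proof -
    have w1: "continuous_on {0..1} (w x)"
    proof -
      have "continuous_on {0..1} (\<lambda>t. (x, t))"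
        by (intro continuous_intros)
      from continuous_on_compose2[OF contw this] show ?thesis
        using that by auto
    qed
    have "((\<lambda>t. t *\<^sub>R g (\<gamma> x t)) has_vector_derivative w x t) (at t within {0..1})" if "t \<in> {0..1}" for t
    proof -
      have y: "\<gamma> x t \<in> S" using \<gamma> that \<open>x \<in> S\<close> by blast
      have "((\<lambda>t. g (\<gamma> x t)) has_derivative (\<lambda>d. g' (\<gamma> x t) (d *\<^sub>R (x - a)))) (at t within {0..1})"
        by (rule has_derivative_compose[where f="\<lambda>t. \<gamma> x t" and g=g, OF _ g[OF y]])
          (auto simp: \<gamma>_def intro!: derivative_eq_intros)
      then have "((\<lambda>t. g (\<gamma> x t)) has_vector_derivative g' (\<gamma> x t) (x - a)) (at t within {0..1})"
        by (simp add: has_vector_derivative_def linear_cmul[OF lin[OF y]])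
      then show ?thesis
        unfolding w_def by (auto intro!: derivative_eq_intros)
    qed
    then have "(w x has_integral (1 *\<^sub>R g (\<gamma> x 1) - 0 *\<^sub>R g (\<gamma> x 0))) {0..1}"
      by (intro fundamental_theorem_of_calculus) auto
    then have wint: "(w x has_integral g x) (cbox 0 1)"
      by (simp add: \<gamma>_def)
    have int: "integral (cbox 0 1) (\<lambda>t. blinfun_inner_right (w x t)) = blinfun_inner_right (g x)"
      using has_integral_linear[OF wint bounded_linear_blinfun_inner_right]
      by (simp add: o_def integral_unique)
    have "(f has_derivative integral (cbox 0 1) (\<lambda>t. blinfun_inner_right (w x t))) (at x within S)"
      unfolding f_def
    proof (rule leibniz_rule[OF _ _ _ that assms(2)])
      show "((\<lambda>x. g (\<gamma> x t) \<bullet> (x - a)) has_derivative blinfun_inner_right (w x t)) (at x within S)"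
        if "x \<in> S" "t \<in> cbox 0 1" for x t
        using D\<gamma> that by simp
      show "(\<lambda>t. g (\<gamma> x t) \<bullet> (x - a)) integrable_on cbox 0 1" if "x \<in> S" for x
        using that \<gamma>
        by (intro integrable_continuous continuous_intros continuous_on_compose2[OF contg])
          (auto simp: \<gamma>_def intro!: continuous_intros)
      show "continuous_on (S \<times> cbox 0 1) (\<lambda>(x, t). blinfun_inner_right (w x t))"
        using contw unfolding split_beta
        by (intro bounded_linear.continuous_on[OF bounded_linear_blinfun_inner_right]) simp
    qed
    then have "(f has_derivative blinfun_inner_right (g x)) (at x)"
      unfolding int at_within_open[OF that assms(1)] .
    then show ?thesis
      unfolding blinfun_inner_right.rep_eq .
  qed
  then show ?thesis by blast
qed auto

text \<open>
  The plane itself and the empty set, which the Riemann mapping theorem excludes, are already convex.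
\<close>

lemma riemann_mapping_convex:
  assumes "open S" "simply_connected (S :: complex set)"
  obtains D \<phi> \<psi> where "open D" "convex D" "\<phi> holomorphic_on D" "\<psi> holomorphic_on S"
    "\<And>z. z \<in> D \<Longrightarrow> \<phi> z \<in> S" "\<And>w. w \<in> S \<Longrightarrow> \<psi> w \<in> D \<and> \<phi> (\<psi> w) = w"
proof -
  consider "S = {} \<or> S = UNIV" | \<phi> \<psi> where "\<psi> holomorphic_on S" "\<phi> holomorphic_on ball 0 1"
    "\<forall>z\<in>S. \<psi> z \<in> ball 0 1 \<and> \<phi> (\<psi> z) = z" "\<forall>z\<in>ball 0 1. \<phi> z \<in> S \<and> \<psi> (\<phi> z) = z"
    using simply_connected_eq_biholomorphic_to_disc[OF assms(1)] assms(2) by blast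
  then show thesis
  proof cases
    case 1
    then show thesis using that[of S id id] by auto
  next
    case 2
    then show thesis using that[of "ball 0 1" \<phi> \<psi>] by auto
  qed
qed

text \<open>
  Multiplication by \<open>a\<close> and by its conjugate are adjoint, so the pullback of the field \<open>g\<close>
  along a holomorphic map \<open>\<phi>\<close> is \<open>cnj \<phi>' * (g \<circ> \<phi>)\<close>.
\<close>

lemma inner_cnj_mult: "(cnj a * b) \<bullet> c = b \<bullet> (a * c)"
  by (simp add: inner_complex_def algebra_simps)

text \<open>
  Symmetry survives the pullback along a holomorphic \<open>\<phi>\<close>: one term of the new derivative is the old
  symmetric form at \<open>\<phi>' h\<close> and \<open>\<phi>' k\<close>, and the other one contains the product \<open>\<phi>'' h k\<close>.
\<close>

lemma poincare_simply_connected_complex: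
  fixes g :: "complex \<Rightarrow> complex"
  assumes "open S" "simply_connected S"
    and g: "\<And>z. z \<in> S \<Longrightarrow> (g has_derivative g' z) (at z)"
    and sym: "\<And>z h k. z \<in> S \<Longrightarrow> g' z h \<bullet> k = g' z k \<bullet> h"
    and cont: "\<And>h. continuous_on S (\<lambda>z. g' z h)"
  shows "\<exists>f. \<forall>z\<in>S. (f has_derivative (\<lambda>h. g z \<bullet> h)) (at z)"
proof -
  obtain D \<phi> \<psi> where D: "open D" "convex D" and hol: "\<phi> holomorphic_on D" "\<psi> holomorphic_on S"
    and \<phi>: "\<And>z. z \<in> D \<Longrightarrow> \<phi> z \<in> S" and \<psi>: "\<And>w. w \<in> S \<Longrightarrow> \<psi> w \<in> D \<and> \<phi> (\<psi> w) = w"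
    using riemann_mapping_convex[OF assms(1,2)] by metis
  define \<phi>' where "\<phi>' = deriv \<phi>"
  have hol': "\<phi>' holomorphic_on D" "deriv \<phi>' holomorphic_on D"
    unfolding \<phi>'_def using hol(1) D(1) by (intro holomorphic_deriv; simp)+
  have d\<phi>: "(\<phi> has_derivative (*) (\<phi>' z)) (at z)" "(\<phi>' has_derivative (*) (deriv \<phi>' z)) (at z)" if "z \<in> D" for z
    using holomorphic_derivI[OF hol(1) D(1) that] holomorphic_derivI[OF hol'(1) D(1) that]
    by (simp_all add: \<phi>'_def has_field_derivative_def)
  have d\<psi>: "(\<psi> has_derivative (*) (deriv \<psi> w)) (at w)" if "w \<in> S" for w
    using holomorphic_derivI[OF hol(2) assms(1) that] by (simp add: has_field_derivative_def)
  have inv: "\<phi>' (\<psi> w) * deriv \<psi> w = 1" if "w \<in> S" for w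
  proof -
    have "((\<lambda>w. \<phi> (\<psi> w)) has_derivative (\<lambda>h. \<phi>' (\<psi> w) * (deriv \<psi> w * h))) (at w)"
      using \<psi>[OF that] by (intro has_derivative_compose[OF d\<psi>[OF that] d\<phi>(1)]) blast
    then have "((\<lambda>w. w) has_derivative (\<lambda>h. \<phi>' (\<psi> w) * (deriv \<psi> w * h))) (at w)"
      by (rule has_derivative_transform_within_open[OF _ assms(1) that]) (use \<psi> in auto)
    then have "(\<lambda>h. h) = (\<lambda>h. \<phi>' (\<psi> w) * (deriv \<psi> w * h))"
      using has_derivative_unique has_derivative_ident by blast
    then show ?thesis by (metis mult_1_right)
  qed
  define G where "G z = cnj (\<phi>' z) * g (\<phi> z)" for z
  define G' where "G' z k = cnj (\<phi>' z) * g' (\<phi> z) (\<phi>' z * k) + cnj (deriv \<phi>' z * k) * g (\<phi> z)" for z k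
  have "(G has_derivative G' z) (at z)" if "z \<in> D" for z
    unfolding G_def G'_def
    by (intro has_derivative_mult has_derivative_cnj has_derivative_compose[OF d\<phi>(1) g] d\<phi>(2) \<phi> that)
  moreover have "G' z h \<bullet> k = G' z k \<bullet> h" if "z \<in> D" for z h k
    using sym[OF \<phi>[OF that], of "\<phi>' z * h" "\<phi>' z * k"]
    unfolding G'_def inner_add_left inner_cnj_mult by (simp add: mult_ac)
  moreover have "continuous_on D (\<lambda>z. G' z h)" for h
  proof -
    have c: "continuous_on D \<phi>" "continuous_on D \<phi>'" "continuous_on D (deriv \<phi>')"
      using hol hol' holomorphic_on_imp_continuous_on by blast+
    have cg: "continuous_on S g"
      using g assms(1) by (auto simp: continuous_on_eq_continuous_at intro: has_derivative_continuous)
    have "linear (g' (\<phi> z))" if "z \<in> D" for z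
      using g[OF \<phi>[OF that]] has_derivative_linear by blast
    moreover have "continuous_on D (\<lambda>z. g' (\<phi> z) k)" for k
      using \<phi> by (intro continuous_on_compose2[OF cont c(1)]) auto
    ultimately have "continuous_on D (\<lambda>z. g' (\<phi> z) (\<phi>' z * h))"
      by (rule continuous_on_apply_linear[where L="\<lambda>z. g' (\<phi> z)"]) (assumption | intro continuous_intros c)+
    moreover have "continuous_on D (\<lambda>z. g (\<phi> z))"
      using \<phi> by (intro continuous_on_compose2[OF cg c(1)]) auto
    ultimately show ?thesis
      unfolding G'_def by (intro continuous_intros c)
  qed
  ultimately obtain F where F: "\<forall>z\<in>D. (F has_derivative (\<lambda>h. G z \<bullet> h)) (at z)"
    using poincare_convex[OF D, of G G'] by blast
  have "((\<lambda>w. F (\<psi> w)) has_derivative (\<lambda>h. g w \<bullet> h)) (at w)" if "w \<in> S" for w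
  proof -
    have "((\<lambda>w. F (\<psi> w)) has_derivative (\<lambda>h. G (\<psi> w) \<bullet> (deriv \<psi> w * h))) (at w)"
      using F \<psi>[OF that] by (intro has_derivative_compose[OF d\<psi>[OF that]]) blast
    also have "(\<lambda>h. G (\<psi> w) \<bullet> (deriv \<psi> w * h)) = (\<lambda>h. g w \<bullet> h)"
      using inv[OF that] \<psi>[OF that] by (simp add: G_def inner_cnj_mult mult.assoc[symmetric])
    finally show ?thesis .
  qed
  then show ?thesis by blast
qed

text \<open>
  Translation of the complex statement to the \<open>(u,v)\<close>-plane: the form \<open>P du + Q dv\<close> is represented by
  the complex-valued field \<open>P + \<i> Q\<close>, and its closedness is the symmetry of the Jacobian matrix.
\<close>

lemma closed_form_potential:
  assumes U: "open U" "simply_connected U"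
    and PQ: "smooth_on U P" "smooth_on U Q"
    and closed: "\<And>p. p \<in> U \<Longrightarrow> dv P p = du Q p"
  obtains f where "\<And>p. p \<in> U \<Longrightarrow> (f has_derivative (\<lambda>h. P p * fst h + Q p * snd h)) (at p)"
proof -
  define j where "j z = (Re z, Im z)" for z
  define g where "g z = Complex (P (j z)) (Q (j z))" for z
  define g' where "g' z h = Complex (Re h * du P (j z) + Im h * dv P (j z)) (Re h * du Q (j z) + Im h * dv Q (j z))" for z h
  define S where "S = j -` U"
  have j: "(j has_derivative j) (at z within A)" for z A
    unfolding j_def by (intro has_derivative_Pair bounded_linear.has_derivative[OF bounded_linear_Re]
        bounded_linear.has_derivative[OF bounded_linear_Im] has_derivative_ident)
  have k: "((\<lambda>p. Complex (fst p) (snd p)) has_derivative (\<lambda>h. Complex (fst h) (snd h))) (at p within A)" for p A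
    unfolding Complex_eq by (auto intro!: derivative_eq_intros)
  have contj: "continuous_on A j" for A
    using j by (auto simp: continuous_on_eq_continuous_within intro: has_derivative_continuous)
  have contk: "continuous_on A (\<lambda>p. Complex (fst p) (snd p))" for A
    using k by (auto simp: continuous_on_eq_continuous_within intro: has_derivative_continuous)
  have "open S"
    unfolding S_def using contj U(1) by (simp add: open_vimage)
  have "homeomorphism S U j (\<lambda>p. Complex (fst p) (snd p))"
    by (rule homeomorphismI[OF contj contk]) (auto simp: S_def j_def)
  then have "U homeomorphic S"
    using homeomorphic_def homeomorphic_sym by blast
  then have "simply_connected S"
    using U(2) homeomorphic_simply_connected_eq by blast
  have dg: "(g has_derivative g' z) (at z)" if "z \<in> S" for z
  proof -
    have "((\<lambda>z. P (j z)) has_derivative (\<lambda>h. fst (j h) *\<^sub>R du P (j z) + snd (j h) *\<^sub>R dv P (j z))) (at z)"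
      "((\<lambda>z. Q (j z)) has_derivative (\<lambda>h. fst (j h) *\<^sub>R du Q (j z) + snd (j h) *\<^sub>R dv Q (j z))) (at z)"
      using that PQ unfolding S_def
      by (intro has_derivative_compose[OF j] smooth_on_has_derivative_du_dv; simp)+
    from has_derivative_compose[OF has_derivative_Pair[OF this] k] show ?thesis
      by (simp add: g_def[abs_def] g'_def[abs_def] j_def)
  qed
  have sym: "g' z h \<bullet> k = g' z k \<bullet> h" if "z \<in> S" for z h k
    using closed[of "j z"] that by (simp add: g'_def S_def inner_complex_def algebra_simps)
  have cont: "continuous_on S (\<lambda>z. g' z h)" for h
  proof -
    have comp: "continuous_on S (\<lambda>z. F (j z))" if "smooth_on U F" for F :: "real \<times> real \<Rightarrow> real"
      using continuous_on_compose2[OF smooth_on_imp_continuous_on[OF that] contj, of S] by (auto simp: S_def)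
    show ?thesis
      unfolding g'_def Complex_eq using U(1) PQ
      by (intro continuous_intros comp smooth_on_du smooth_on_dv)
  qed
  obtain F where F: "\<forall>z\<in>S. (F has_derivative (\<lambda>h. g z \<bullet> h)) (at z)"
    using poincare_simply_connected_complex[OF \<open>open S\<close> \<open>simply_connected S\<close> dg sym cont] by blast
  have "((\<lambda>p. F (Complex (fst p) (snd p))) has_derivative (\<lambda>h. P p * fst h + Q p * snd h)) (at p)"
    if "p \<in> U" for p
  proof -
    have "((\<lambda>p. F (Complex (fst p) (snd p))) has_derivative
        (\<lambda>h. g (Complex (fst p) (snd p)) \<bullet> Complex (fst h) (snd h))) (at p)"
      using F that by (intro has_derivative_compose[OF k]) (auto simp: S_def j_def)
    then show ?thesis
      by (simp add: g_def j_def inner_complex_def)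
  qed
  then show thesis by (rule that)
qed

section \<open>Integrals of exact forms\<close>

text \<open>
  The fundamental theorem of calculus along the path; the finitely many corners of a piecewise
  \<open>C\<^sup>1\<close> path do not matter for the integral.
\<close>

lemma line_integral_exact:
  assumes f: "\<And>p. p \<in> path_image c \<Longrightarrow> (f has_derivative (\<lambda>h. P p * fst h + Q p * snd h)) (at p)"
    and "valid_path c"
  shows "line_integral P Q c = f (pathfinish c) - f (pathstart c)"
proof -
  obtain T where T: "finite T" "continuous_on {0..1} c" "c C1_differentiable_on {0..1} - T"
    using assms(2) unfolding valid_path_def piecewise_C1_differentiable_on_def by blast
  have contf: "continuous_on (path_image c) f"
    using f by (auto simp: continuous_on_eq_continuous_within intro: has_derivative_at_withinI has_derivative_continuous)
  have "((\<lambda>\<tau>. P (c \<tau>) * fst (vector_derivative c (at \<tau>)) + Q (c \<tau>) * snd (vector_derivative c (at \<tau>)))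
      has_integral (f (c 1) - f (c 0))) {0..1}"
  proof (rule fundamental_theorem_of_calculus_interior_strong[OF T(1)])
    show "continuous_on {0..1} (\<lambda>\<tau>. f (c \<tau>))"
      using continuous_on_compose2[OF contf T(2)] by (auto simp: path_image_def)
    fix \<tau> assume \<tau>: "\<tau> \<in> {0<..<1} - T"
    have "(c has_vector_derivative vector_derivative c (at \<tau>)) (at \<tau>)"
      using T(3) \<tau> by (auto simp: C1_differentiable_on_eq vector_derivative_works)
    moreover have "c \<tau> \<in> path_image c"
      using \<tau> by (auto simp: path_image_def)
    ultimately have "((\<lambda>\<tau>. f (c \<tau>)) has_derivative
        (\<lambda>d. P (c \<tau>) * fst (d *\<^sub>R vector_derivative c (at \<tau>)) + Q (c \<tau>) * snd (d *\<^sub>R vector_derivative c (at \<tau>)))) (at \<tau>)"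
      unfolding has_vector_derivative_def
      by (intro has_derivative_compose[where g=f, OF _ f])
    then show "((\<lambda>\<tau>. f (c \<tau>)) has_vector_derivative
        P (c \<tau>) * fst (vector_derivative c (at \<tau>)) + Q (c \<tau>) * snd (vector_derivative c (at \<tau>))) (at \<tau>)"
      by (simp add: has_vector_derivative_def algebra_simps)
  qed simp
  then show ?thesis
    by (simp add: line_integral_def integral_unique pathfinish_def pathstart_def)
qed

lemma vertical_segment:
  "min a b \<le> v \<Longrightarrow> v \<le> max a b \<Longrightarrow> (c, v) \<in> closed_segment (c, a) (c, b)"
  and horizontal_segment:
  "min a b \<le> v \<Longrightarrow> v \<le> max a b \<Longrightarrow> (v, c) \<in> closed_segment (a, c) (b, c)" for a b c v :: real
proof -
  assume "min a b \<le> v" "v \<le> max a b"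
  then have "v \<in> closed_segment a b"
    by (auto simp: closed_segment_eq_real_ivl)
  then obtain t where "0 \<le> t" "t \<le> 1" "v = (1 - t) *\<^sub>R a + t *\<^sub>R b"
    by (auto simp: in_segment)
  then show "(c, v) \<in> closed_segment (c, a) (c, b)" "(v, c) \<in> closed_segment (a, c) (b, c)"
    by (auto simp: in_segment algebra_simps intro!: exI[of _ t])
qed

text \<open>
  Both ways of reading the integral, along the two axis-parallel segments and along a chosen path, give the difference
  of a potential at the end points.
\<close>

lemma form_integral_exact:
  assumes c: "path_choice U p0 c" and p: "p \<in> U"
    and PQ: "continuous_on U P" "continuous_on U Q"
    and f: "\<And>p. p \<in> U \<Longrightarrow> (f has_derivative (\<lambda>h. P p * fst h + Q p * snd h)) (at p)"
  shows "form_integral U p0 c P Q p = f p - f p0"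
proof (cases "L_path p0 p \<subseteq> U")
  case True
  have v: "(fst p0, v) \<in> U" if "min (snd p0) (snd p) \<le> v" "v \<le> max (snd p0) (snd p)" for v
  proof -
    have "(fst p0, v) \<in> closed_segment p0 (fst p0, snd p)"
      using that vertical_segment[where a="snd p0" and b="snd p" and c="fst p0"] by simp
    then show ?thesis using True by (auto simp: L_path_def)
  qed
  have u: "(u, snd p) \<in> U" if "min (fst p0) (fst p) \<le> u" "u \<le> max (fst p0) (fst p)" for u
  proof -
    have "(u, snd p) \<in> closed_segment (fst p0, snd p) p"
      using that horizontal_segment[where a="fst p0" and b="fst p" and c="snd p"] by simp
    then show ?thesis using True by (auto simp: L_path_def)
  qed
  have "(LBINT u=fst p0..fst p. P (u, snd p)) = f (fst p, snd p) - f (fst p0, snd p)"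
  proof (rule interval_integral_FTC_finite)
    show "continuous_on {min (fst p0) (fst p)..max (fst p0) (fst p)} (\<lambda>u. P (u, snd p))"
      using u by (intro continuous_on_compose2[OF PQ(1)] continuous_intros) auto
    fix u assume "min (fst p0) (fst p) \<le> u" "u \<le> max (fst p0) (fst p)"
    from f[OF u[OF this]] show "((\<lambda>u. f (u, snd p)) has_vector_derivative P (u, snd p))
        (at u within {min (fst p0) (fst p)..max (fst p0) (fst p)})"
      unfolding has_vector_derivative_def
      by (rule has_derivative_compose[where f="\<lambda>u. (u, snd p)" and f'="\<lambda>d. (d, 0)" and g=f, THEN has_derivative_eq_rhs, rotated])
        (auto intro!: derivative_eq_intros)
  qed
  moreover have "(LBINT v=snd p0..snd p. Q (fst p0, v)) = f (fst p0, snd p) - f (fst p0, snd p0)"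
  proof (rule interval_integral_FTC_finite)
    show "continuous_on {min (snd p0) (snd p)..max (snd p0) (snd p)} (\<lambda>v. Q (fst p0, v))"
      using v by (intro continuous_on_compose2[OF PQ(2)] continuous_intros) auto
    fix v assume "min (snd p0) (snd p) \<le> v" "v \<le> max (snd p0) (snd p)"
    from f[OF v[OF this]] show "((\<lambda>v. f (fst p0, v)) has_vector_derivative Q (fst p0, v))
        (at v within {min (snd p0) (snd p)..max (snd p0) (snd p)})"
      unfolding has_vector_derivative_def
      by (rule has_derivative_compose[where f="\<lambda>v. (fst p0, v)" and f'="\<lambda>d. (0, d)" and g=f, THEN has_derivative_eq_rhs, rotated])
        (auto intro!: derivative_eq_intros)
  qed
  ultimately show ?thesis
    using True by (simp add: form_integral_def)
next
  case False
  have "line_integral P Q (c p) = f (pathfinish (c p)) - f (pathstart (c p))"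
    using c p by (intro line_integral_exact f) (auto simp: path_choice_def)
  then show ?thesis
    using False c p by (simp add: form_integral_def path_choice_def)
qed

section \<open>Partial derivatives of products\<close>

lemma du_cong: "open U \<Longrightarrow> p \<in> U \<Longrightarrow> smooth_on U f \<Longrightarrow> (\<And>q. q \<in> U \<Longrightarrow> f q = g q) \<Longrightarrow> du f p = du g p"
  and dv_cong: "open U \<Longrightarrow> p \<in> U \<Longrightarrow> smooth_on U f \<Longrightarrow> (\<And>q. q \<in> U \<Longrightarrow> f q = g q) \<Longrightarrow> dv f p = dv g p"
proof -
  assume A: "open U" "p \<in> U" "smooth_on U f" "\<And>q. q \<in> U \<Longrightarrow> f q = g q"
  have "(g has_derivative (\<lambda>h. fst h *\<^sub>R du f p + snd h *\<^sub>R dv f p)) (at p)"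
    by (rule has_derivative_transform_within_open[OF smooth_on_has_derivative_du_dv[OF A(3,2)] A(1,2,4)])
  then show "du f p = du g p" "dv f p = dv g p"
    by (simp_all add: du_eqI dv_eqI)
qed

lemma
  assumes "smooth_on U f" "smooth_on U g" "p \<in> U"
  shows du_inner: "du (\<lambda>p. f p \<bullet> g p) p = f p \<bullet> du g p + du f p \<bullet> g p"
    and dv_inner: "dv (\<lambda>p. f p \<bullet> g p) p = f p \<bullet> dv g p + dv f p \<bullet> g p"
  using du_eqI[OF has_derivative_inner[OF assms(1,2)[THEN smooth_on_has_derivative_du_dv, OF assms(3)]]]
    dv_eqI[OF has_derivative_inner[OF assms(1,2)[THEN smooth_on_has_derivative_du_dv, OF assms(3)]]]
  by simp_all

lemma
  assumes "smooth_on U f" "smooth_on U lam" "smooth_on U g" "p \<in> U"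
  shows du_add_scaleR: "du (\<lambda>p. f p + lam p *\<^sub>R g p) p = du f p + (lam p *\<^sub>R du g p + du lam p *\<^sub>R g p)"
    and dv_add_scaleR: "dv (\<lambda>p. f p + lam p *\<^sub>R g p) p = dv f p + (lam p *\<^sub>R dv g p + dv lam p *\<^sub>R g p)"
proof -
  note D = has_derivative_add[OF smooth_on_has_derivative_du_dv[OF assms(1,4)]
      has_derivative_scaleR[OF smooth_on_has_derivative_du_dv[OF assms(2,4)] smooth_on_has_derivative_du_dv[OF assms(3,4)]]]
  show "du (\<lambda>p. f p + lam p *\<^sub>R g p) p = du f p + (lam p *\<^sub>R du g p + du lam p *\<^sub>R g p)"
    "dv (\<lambda>p. f p + lam p *\<^sub>R g p) p = dv f p + (lam p *\<^sub>R dv g p + dv lam p *\<^sub>R g p)"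
    using du_eqI[OF D] dv_eqI[OF D] by simp_all
qed

lemma
  assumes "open U" "p \<in> U" "smooth_on U f" "smooth_on U g" "\<And>q. q \<in> U \<Longrightarrow> f q \<bullet> g q = k"
  shows du_inner_constant: "f p \<bullet> du g p + du f p \<bullet> g p = 0"
    and dv_inner_constant: "f p \<bullet> dv g p + dv f p \<bullet> g p = 0"
proof -
  have D: "((\<lambda>q. f q \<bullet> g q) has_derivative (\<lambda>h. 0)) (at p)"
    by (rule has_derivative_transform_within_open[OF has_derivative_const[of k] assms(1,2)]) (use assms(5) in simp)
  show "f p \<bullet> du g p + du f p \<bullet> g p = 0" "f p \<bullet> dv g p + dv f p \<bullet> g p = 0"
    using du_inner[OF assms(3,4,2)] dv_inner[OF assms(3,4,2)] du_eqI[OF D] dv_eqI[OF D] by simp_all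
qed

section \<open>The moving frame of a framed surface\<close>

lemma sin_cos_products:
  fixes y :: real and v :: "'a::real_vector"
  shows "cos y * cos y + sin y * sin y = 1" "sin y * sin y + cos y * cos y = 1"
    "(cos y * cos y) *\<^sub>R v + (sin y * sin y) *\<^sub>R v = v" "(sin y * sin y) *\<^sub>R v + (cos y * cos y) *\<^sub>R v = v"
  by (simp_all add: scaleR_left_distrib[symmetric] power2_eq_square[symmetric])

lemma orthonormal_cross_frame:
  fixes n s :: "real^3"
  assumes "n \<bullet> n = 1" "s \<bullet> s = 1" "n \<bullet> s = 0"
  shows "cross3 s (cross3 n s) = n" "cross3 (cross3 n s) n = s" "cross3 n s \<bullet> cross3 n s = 1"
proof -
  have "cross3 (cross3 n s) n = - cross3 n (cross3 n s)"
    by (rule cross_skew)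
  then show "cross3 (cross3 n s) n = s"
    using assms by (simp add: Lagrange)
qed (use assms in \<open>simp_all add: Lagrange dot_cross inner_commute\<close>)

text \<open>
  With \<open>t = n \<times> s\<close>, expand \<open>t \<times> (w \<times> t) = w - (t \<bullet> w) t\<close> in a second way, by inserting \<open>w \<times> (n \<times> s)\<close>.
\<close>

lemma orthonormal_expansion:
  fixes n s w :: "real^3"
  assumes "n \<bullet> n = 1" "s \<bullet> s = 1" "n \<bullet> s = 0"
  shows "w = (w \<bullet> n) *\<^sub>R n + (w \<bullet> s) *\<^sub>R s + (w \<bullet> cross3 n s) *\<^sub>R cross3 n s"
proof -
  let ?t = "cross3 n s"
  note f = orthonormal_cross_frame[OF assms]
  have "cross3 ?t (cross3 w ?t) = w - (?t \<bullet> w) *\<^sub>R ?t"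
    unfolding Lagrange[of ?t w ?t] using f(3) by simp
  moreover have "cross3 w ?t = (w \<bullet> s) *\<^sub>R n - (w \<bullet> n) *\<^sub>R s"
    by (simp add: Lagrange)
  moreover have "cross3 ?t s = - n"
    by (subst cross_skew) (simp add: f(1))
  ultimately show ?thesis
    by (simp add: f(2) Cross3.right_diff_distrib cross_mult_right inner_commute[of ?t w] eq_diff_eq add_ac)
qed

locale framed =
  fixes U :: "(real \<times> real) set" and F :: triple_map
  assumes open_U: "open U" and framed: "framed_surface U F"
begin

abbreviation "x \<equiv> xmap F"
abbreviation "n \<equiv> nmap F"
abbreviation "s \<equiv> smap F"
abbreviation "t \<equiv> tmap F"

lemma smooth_maps: "smooth_on U x" "smooth_on U n" "smooth_on U s" "smooth_on U t"
proof -
  have F: "smooth_on U F" using framed by (simp add: framed_surface_def)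
  show 1: "smooth_on U x" "smooth_on U n" "smooth_on U s"
    unfolding xmap_def[abs_def] nmap_def[abs_def] smap_def[abs_def]
    by (intro smooth_intros open_U F)+
  show "smooth_on U t"
    unfolding tmap_def[abs_def] by (intro smooth_intros open_U 1)
qed

lemma frame:
  assumes "p \<in> U"
  shows "n p \<bullet> n p = 1" "s p \<bullet> s p = 1" "t p \<bullet> t p = 1"
    "n p \<bullet> s p = 0" "n p \<bullet> t p = 0" "s p \<bullet> t p = 0" "s p \<bullet> n p = 0" "t p \<bullet> n p = 0" "t p \<bullet> s p = 0"
    "cross3 (n p) (s p) = t p" "cross3 (s p) (t p) = n p" "cross3 (t p) (n p) = s p"
    "cross3 (s p) (n p) = - t p" "cross3 (t p) (s p) = - n p" "cross3 (n p) (t p) = - s p"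
proof -
  have *: "n p \<bullet> n p = 1" "s p \<bullet> s p = 1" "n p \<bullet> s p = 0"
    using framed assms by (auto simp: framed_surface_def Delta_def norm_eq_1)
  note f = orthonormal_cross_frame[OF *, folded tmap_def]
  show "n p \<bullet> n p = 1" "s p \<bullet> s p = 1" "t p \<bullet> t p = 1"
    "n p \<bullet> s p = 0" "n p \<bullet> t p = 0" "s p \<bullet> t p = 0" "s p \<bullet> n p = 0" "t p \<bullet> n p = 0" "t p \<bullet> s p = 0"
    "cross3 (n p) (s p) = t p" "cross3 (s p) (t p) = n p" "cross3 (t p) (n p) = s p"
    "cross3 (s p) (n p) = - t p" "cross3 (t p) (s p) = - n p" "cross3 (n p) (t p) = - s p"
    using * f cross_skew[of "s p" "n p"] cross_skew[of "t p" "s p"] cross_skew[of "n p" "t p"]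
    by (simp_all add: inner_commute tmap_def dot_cross_self)
qed

lemma frame_expansion: "p \<in> U \<Longrightarrow> w = (w \<bullet> n p) *\<^sub>R n p + (w \<bullet> s p) *\<^sub>R s p + (w \<bullet> t p) *\<^sub>R t p"
  unfolding tmap_def by (rule orthonormal_expansion) (simp_all add: frame)

lemma tangent: "p \<in> U \<Longrightarrow> du x p \<bullet> n p = 0" "p \<in> U \<Longrightarrow> dv x p \<bullet> n p = 0"
  using framed by (auto simp: framed_surface_def)

lemma structure_equations:
  assumes "basic_invariants U F I" "p \<in> U"
  shows "du x p = inv_a1 I p *\<^sub>R s p + inv_b1 I p *\<^sub>R t p"
    "du n p = inv_e1 I p *\<^sub>R s p + inv_f1 I p *\<^sub>R t p"
    "du s p = - inv_e1 I p *\<^sub>R n p + inv_g1 I p *\<^sub>R t p"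
    "du t p = - inv_f1 I p *\<^sub>R n p - inv_g1 I p *\<^sub>R s p"
    "dv x p = inv_a2 I p *\<^sub>R s p + inv_b2 I p *\<^sub>R t p"
    "dv n p = inv_e2 I p *\<^sub>R s p + inv_f2 I p *\<^sub>R t p"
    "dv s p = - inv_e2 I p *\<^sub>R n p + inv_g2 I p *\<^sub>R t p"
    "dv t p = - inv_f2 I p *\<^sub>R n p - inv_g2 I p *\<^sub>R s p"
  using assms unfolding basic_invariants_def by simp_all

text \<open>
  Any invariants of the same surface agree on \<open>U\<close>, so statements about all of them can be checked on
  inner products with the frame.
\<close>

lemma basic_invariants_eq_inner:
  assumes "basic_invariants U F I" "p \<in> U"
  shows "inv_a1 I p = du x p \<bullet> s p" "inv_b1 I p = du x p \<bullet> t p"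
    "inv_e1 I p = du n p \<bullet> s p" "inv_f1 I p = du n p \<bullet> t p" "inv_g1 I p = du s p \<bullet> t p"
    "inv_a2 I p = dv x p \<bullet> s p" "inv_b2 I p = dv x p \<bullet> t p"
    "inv_e2 I p = dv n p \<bullet> s p" "inv_f2 I p = dv n p \<bullet> t p" "inv_g2 I p = dv s p \<bullet> t p"
  unfolding structure_equations[OF assms] using frame[OF assms(2)]
  by (simp_all add: inner_add_left inner_diff_left)

text \<open>
  The inner products with the frame are invariants: the missing coefficients of the derivatives vanish or
  are determined up to sign, because the inner products of the frame vectors with one another are constant.
\<close>

lemma basic_invariants_exist: "\<exists>I. basic_invariants U F I"
proof -
  define I where "I = \<lparr>inv_a1 = \<lambda>p. du x p \<bullet> s p, inv_b1 = \<lambda>p. du x p \<bullet> t p,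
    inv_e1 = \<lambda>p. du n p \<bullet> s p, inv_f1 = \<lambda>p. du n p \<bullet> t p, inv_g1 = \<lambda>p. du s p \<bullet> t p,
    inv_a2 = \<lambda>p. dv x p \<bullet> s p, inv_b2 = \<lambda>p. dv x p \<bullet> t p,
    inv_e2 = \<lambda>p. dv n p \<bullet> s p, inv_f2 = \<lambda>p. dv n p \<bullet> t p, inv_g2 = \<lambda>p. dv s p \<bullet> t p\<rparr>"
  have "smooth_on U (inv_a1 I) \<and> smooth_on U (inv_b1 I) \<and> smooth_on U (inv_e1 I) \<and>
     smooth_on U (inv_f1 I) \<and> smooth_on U (inv_g1 I) \<and>
     smooth_on U (inv_a2 I) \<and> smooth_on U (inv_b2 I) \<and> smooth_on U (inv_e2 I) \<and>
     smooth_on U (inv_f2 I) \<and> smooth_on U (inv_g2 I)"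
    unfolding I_def using open_U smooth_maps by (simp add: smooth_intros)
  moreover have "du x p = inv_a1 I p *\<^sub>R s p + inv_b1 I p *\<^sub>R t p \<and>
        du n p = inv_e1 I p *\<^sub>R s p + inv_f1 I p *\<^sub>R t p \<and>
        du s p = - inv_e1 I p *\<^sub>R n p + inv_g1 I p *\<^sub>R t p \<and>
        du t p = - inv_f1 I p *\<^sub>R n p - inv_g1 I p *\<^sub>R s p \<and>
        dv x p = inv_a2 I p *\<^sub>R s p + inv_b2 I p *\<^sub>R t p \<and>
        dv n p = inv_e2 I p *\<^sub>R s p + inv_f2 I p *\<^sub>R t p \<and>
        dv s p = - inv_e2 I p *\<^sub>R n p + inv_g2 I p *\<^sub>R t p \<and>
        dv t p = - inv_f2 I p *\<^sub>R n p - inv_g2 I p *\<^sub>R s p" if p: "p \<in> U" for p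
  proof -
    note Du = du_inner_constant[OF open_U p] and Dv = dv_inner_constant[OF open_U p] and S = smooth_maps(2-4)
    have u: "du n p \<bullet> n p = 0" "du s p \<bullet> s p = 0" "du t p \<bullet> t p = 0"
      "du s p \<bullet> n p = - (du n p \<bullet> s p)" "du t p \<bullet> n p = - (du n p \<bullet> t p)" "du t p \<bullet> s p = - (du s p \<bullet> t p)"
      using Du[OF S(1) S(1) frame(1)] Du[OF S(2) S(2) frame(2)] Du[OF S(3) S(3) frame(3)]
        Du[OF S(1) S(2) frame(4)] Du[OF S(1) S(3) frame(5)] Du[OF S(2) S(3) frame(6)]
      by (simp_all add: inner_commute)
    have v: "dv n p \<bullet> n p = 0" "dv s p \<bullet> s p = 0" "dv t p \<bullet> t p = 0"
      "dv s p \<bullet> n p = - (dv n p \<bullet> s p)" "dv t p \<bullet> n p = - (dv n p \<bullet> t p)" "dv t p \<bullet> s p = - (dv s p \<bullet> t p)"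
      using Dv[OF S(1) S(1) frame(1)] Dv[OF S(2) S(2) frame(2)] Dv[OF S(3) S(3) frame(3)]
        Dv[OF S(1) S(2) frame(4)] Dv[OF S(1) S(3) frame(5)] Dv[OF S(2) S(3) frame(6)]
      by (simp_all add: inner_commute)
    show ?thesis
      by (intro conjI; rule trans[OF frame_expansion[OF p]]; simp add: I_def u v tangent[OF p])
  qed
  ultimately show ?thesis
    unfolding basic_invariants_def by blast
qed

text \<open>
  Differentiate \<open>a\<^sub>1 = x\<^sub>u \<bullet> s\<close> by \<open>v\<close> and \<open>a\<^sub>2 = x\<^sub>v \<bullet> s\<close> by \<open>u\<close>; the second derivatives of \<open>x\<close> cancel and the
  rest is read off from the derivatives of \<open>s\<close>. The same with \<open>t\<close> in place of \<open>s\<close> gives the other equation.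
\<close>

lemma integrability:
  assumes I: "basic_invariants U F I" and p: "p \<in> U"
  shows "dv (inv_a1 I) p - du (inv_a2 I) p = inv_b1 I p * inv_g2 I p - inv_b2 I p * inv_g1 I p"
    and "dv (inv_b1 I) p - du (inv_b2 I) p = inv_a2 I p * inv_g1 I p - inv_a1 I p * inv_g2 I p"
proof -
  note inner = basic_invariants_eq_inner[OF I]
  have smooth: "smooth_on U (inv_a1 I)" "smooth_on U (inv_a2 I)" "smooth_on U (inv_b1 I)" "smooth_on U (inv_b2 I)"
    using I unfolding basic_invariants_def by simp_all
  note S = smooth_maps smooth_on_du[OF open_U smooth_maps(1)] smooth_on_dv[OF open_U smooth_maps(1)]
  have mixed: "dv (du x) p = du (dv x) p"
    by (rule dv_du_eq_du_dv[OF open_U smooth_maps(1) p])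
  have "dv (inv_a1 I) p = du x p \<bullet> dv s p + dv (du x) p \<bullet> s p"
    "du (inv_a2 I) p = dv x p \<bullet> du s p + du (dv x) p \<bullet> s p"
    "dv (inv_b1 I) p = du x p \<bullet> dv t p + dv (du x) p \<bullet> t p"
    "du (inv_b2 I) p = dv x p \<bullet> du t p + du (dv x) p \<bullet> t p"
    using dv_cong[OF open_U p smooth(1) inner(1)] du_cong[OF open_U p smooth(2) inner(6)]
      dv_cong[OF open_U p smooth(3) inner(2)] du_cong[OF open_U p smooth(4) inner(7)]
    by (simp_all add: dv_inner[OF S(5) S(3) p] du_inner[OF S(6) S(3) p] dv_inner[OF S(5) S(4) p] du_inner[OF S(6) S(4) p])
  then show "dv (inv_a1 I) p - du (inv_a2 I) p = inv_b1 I p * inv_g2 I p - inv_b2 I p * inv_g1 I p"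
    "dv (inv_b1 I) p - du (inv_b2 I) p = inv_a2 I p * inv_g1 I p - inv_a1 I p * inv_g2 I p"
    unfolding mixed structure_equations[OF I p] using frame[OF p]
    by (simp_all add: inner_add_left inner_add_right inner_diff_right algebra_simps)
qed

end

section \<open>Displacements as integrals\<close>

text \<open>
  For the involutes: the displacement is smooth and its differential is the negative of the form.
\<close>

lemma form_integral_closed:
  assumes U: "open U" "simply_connected U" "path_choice U p0 c"
    and PQ: "smooth_on U P" "smooth_on U Q" "\<And>p. p \<in> U \<Longrightarrow> dv P p = du Q p"
    and L: "L = (\<lambda>p. - form_integral U p0 c P Q p)"
  shows "smooth_on U L" "\<And>p. p \<in> U \<Longrightarrow> du L p = - P p" "\<And>p. p \<in> U \<Longrightarrow> dv L p = - Q p"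
proof -
  obtain f where f: "\<And>p. p \<in> U \<Longrightarrow> (f has_derivative (\<lambda>h. P p * fst h + Q p * snd h)) (at p)"
    using closed_form_potential[OF U(1,2) PQ] by blast
  have D: "(L has_derivative (\<lambda>h. - P p * fst h - Q p * snd h)) (at p)" if p: "p \<in> U" for p
  proof (rule has_derivative_transform_within_open[OF _ U(1) p])
    show "((\<lambda>q. f p0 - f q) has_derivative (\<lambda>h. - P p * fst h - Q p * snd h)) (at p)"
      using has_derivative_diff[OF has_derivative_const f[OF p], of "f p0"] by (simp add: algebra_simps)
    show "f p0 - f q = L q" if "q \<in> U" for q
      using form_integral_exact[OF U(3) that PQ(1,2)[THEN smooth_on_imp_continuous_on] f]
      by (simp add: L)
  qed
  show "smooth_on U L"
    by (rule smooth_onI_derivative[OF U(1) D]) (assumption | intro smooth_intros U(1) PQ(1,2))+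
  show "du L p = - P p" "dv L p = - Q p" if "p \<in> U" for p
    using du_eqI[OF D[OF that]] dv_eqI[OF D[OF that]] by simp_all
qed

text \<open>
  For the caustics: the displacement of the involute undoes the one of the caustic up to a constant.
\<close>

lemma form_integral_gradient:
  assumes "open U" "path_choice U p0 c" "p \<in> U" "smooth_on U f"
    and PQ: "\<And>q. q \<in> U \<Longrightarrow> P q = du f q" "\<And>q. q \<in> U \<Longrightarrow> Q q = dv f q"
  shows "form_integral U p0 c P Q p = f p - f p0"
proof (rule form_integral_exact[OF assms(2,3)])
  show "continuous_on U P" "continuous_on U Q"
    using assms smooth_on_imp_continuous_on[OF smooth_on_du[OF assms(1,4)]]
      smooth_on_imp_continuous_on[OF smooth_on_dv[OF assms(1,4)]]
    by (simp_all cong: continuous_on_cong)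
  show "(f has_derivative (\<lambda>h. P p * fst h + Q p * snd h)) (at p)" if "p \<in> U" for p
    using smooth_on_has_derivative_du_dv[OF assms(4) that] that by (simp add: PQ mult.commute)
qed

lemma smooth_on_triple:
  assumes "open U" "smooth_on U f" "smooth_on U g" "smooth_on U h"
  shows "smooth_on U (\<lambda>p. (f p, g p, h p))"
  by (intro smooth_intros assms)

section \<open>Caustics and involutes\<close>

context framed begin

text \<open>
  The assumption on \<open>lam\<close> cancels the \<open>s\<close>-component of the derivative of \<open>x\<close>, and the derivative of \<open>s\<close> is orthogonal to
  \<open>s\<close>; hence \<open>s\<close> is normal to the involute. In the condition for the caustic the term with \<open>lam\<close> disappears, since
  moving back by \<open>- lam\<close> undoes the displacement. What remains is \<open>b\<^sub>i t\<close>, which is orthogonal to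
  \<open>sin (-\<theta>) S + cos (-\<theta>) T = n\<close>, where \<open>S\<close> and \<open>T\<close> are the tangent vectors of the new frame.
\<close>

lemma framed_involute_s:
  assumes "basic_invariants U F I" "smooth_on U lam" "smooth_on U \<theta>"
    and lam: "\<And>p. p \<in> U \<Longrightarrow> du lam p = - inv_a1 I p" "\<And>p. p \<in> U \<Longrightarrow> dv lam p = - inv_a2 I p"
  defines "G \<equiv> involute_s lam \<theta> F"
  shows "framed_surface U G"
    and "\<And>J. basic_invariants U G J \<Longrightarrow> caustic_s_cond U J (\<lambda>p. - lam p) (\<lambda>p. - \<theta> p)"
    and "\<And>p. p \<in> U \<Longrightarrow> caustic_s (\<lambda>p. - lam p) (\<lambda>p. - \<theta> p) G p = (x p, n p, s p)"
proof -
  have X: "xmap G = (\<lambda>p. x p + lam p *\<^sub>R s p)" and N: "nmap G = s"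
    and S: "smap G = (\<lambda>p. cos (\<theta> p) *\<^sub>R t p - sin (\<theta> p) *\<^sub>R n p)"
    by (simp_all add: G_def involute_s_def xmap_def nmap_def smap_def tmap_def fun_eq_iff)
  have T: "tmap G p = cos (\<theta> p) *\<^sub>R n p + sin (\<theta> p) *\<^sub>R t p" if "p \<in> U" for p
    using frame[OF that]
    by (simp add: tmap_def[of G] N S Cross3.right_diff_distrib cross_mult_right)
  have dX: "du (xmap G) p = inv_b1 I p *\<^sub>R t p + lam p *\<^sub>R du s p"
    "dv (xmap G) p = inv_b2 I p *\<^sub>R t p + lam p *\<^sub>R dv s p" if "p \<in> U" for p
    unfolding X using that lam structure_equations(1,5)[OF assms(1) that]
    by (simp_all add: du_add_scaleR[OF smooth_maps(1) assms(2) smooth_maps(3)]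
        dv_add_scaleR[OF smooth_maps(1) assms(2) smooth_maps(3)])
  show framed_G: "framed_surface U G"
    unfolding framed_surface_def
  proof (intro conjI ballI)
    show "smooth_on U G"
      unfolding G_def involute_s_def[abs_def]
      by (intro smooth_on_triple smooth_intros smooth_maps open_U assms)
    fix p assume p: "p \<in> U"
    note f = frame[OF p]
    show "(nmap G p, smap G p) \<in> Delta"
      using f unfolding Delta_def N S
      by (simp add: norm_eq_1 sin_cos_products inner_diff_left inner_diff_right)
    show "du (xmap G) p \<bullet> nmap G p = 0" "dv (xmap G) p \<bullet> nmap G p = 0"
      using f structure_equations(3,7)[OF assms(1) p]
      by (simp_all add: dX[OF p] N inner_add_left inner_diff_left)
  qed
  interpret G: framed U G
    by unfold_locales (rule open_U framed_G)+
  show "caustic_s_cond U J (\<lambda>p. - lam p) (\<lambda>p. - \<theta> p)" if J: "basic_invariants U G J" for J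
    unfolding caustic_s_cond_def
  proof (intro conjI ballI)
    fix p assume p: "p \<in> U"
    note f = frame[OF p] and J' = G.basic_invariants_eq_inner[OF J p]
    show "(inv_a1 J p + - lam p * inv_e1 J p) * sin (- \<theta> p) + (inv_b1 J p + - lam p * inv_f1 J p) * cos (- \<theta> p) = 0"
      "(inv_a2 J p + - lam p * inv_e2 J p) * sin (- \<theta> p) + (inv_b2 J p + - lam p * inv_f2 J p) * cos (- \<theta> p) = 0"
      unfolding J' dX[OF p] T[OF p] N S
      using f by (simp_all add: inner_add_left inner_diff_left inner_add_right inner_diff_right algebra_simps)
  qed (intro smooth_intros open_U assms)+
  show "caustic_s (\<lambda>p. - lam p) (\<lambda>p. - \<theta> p) G p = (x p, n p, s p)" if p: "p \<in> U" for p
  proof -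
    have "sin (- \<theta> p) *\<^sub>R smap G p + cos (- \<theta> p) *\<^sub>R tmap G p
        = n p"
      unfolding T[OF p] S by (simp add: sin_cos_products algebra_simps)
    then show ?thesis
      unfolding caustic_s_def by (simp add: X N)
  qed
qed

text \<open>
  As for \<open>framed_involute_s\<close>, with \<open>t\<close> as new normal; what remains in the condition is \<open>a\<^sub>i s\<close>, which
  is orthogonal to \<open>cos (-\<theta>) S - sin (-\<theta>) T = n\<close>.
\<close>

lemma framed_involute_t:
  assumes "basic_invariants U F I" "smooth_on U lam" "smooth_on U \<theta>"
    and lam: "\<And>p. p \<in> U \<Longrightarrow> du lam p = - inv_b1 I p" "\<And>p. p \<in> U \<Longrightarrow> dv lam p = - inv_b2 I p"
  defines "G \<equiv> involute_t lam \<theta> F"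
  shows "framed_surface U G"
    and "\<And>J. basic_invariants U G J \<Longrightarrow> caustic_t_cond U J (\<lambda>p. - lam p) (\<lambda>p. - \<theta> p)"
    and "\<And>p. p \<in> U \<Longrightarrow> caustic_t (\<lambda>p. - lam p) (\<lambda>p. - \<theta> p) G p = (x p, n p, s p)"
proof -
  have X: "xmap G = (\<lambda>p. x p + lam p *\<^sub>R t p)" and N: "nmap G = t"
    and S: "smap G = (\<lambda>p. cos (\<theta> p) *\<^sub>R n p - sin (\<theta> p) *\<^sub>R s p)"
    by (simp_all add: G_def involute_t_def xmap_def nmap_def smap_def tmap_def fun_eq_iff)
  have T: "tmap G p = cos (\<theta> p) *\<^sub>R s p + sin (\<theta> p) *\<^sub>R n p" if "p \<in> U" for p
    using frame[OF that]
    by (simp add: tmap_def[of G] N S Cross3.right_diff_distrib cross_mult_right)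
  have dX: "du (xmap G) p = inv_a1 I p *\<^sub>R s p + lam p *\<^sub>R du t p"
    "dv (xmap G) p = inv_a2 I p *\<^sub>R s p + lam p *\<^sub>R dv t p" if "p \<in> U" for p
    unfolding X using that lam structure_equations(1,5)[OF assms(1) that]
    by (simp_all add: du_add_scaleR[OF smooth_maps(1) assms(2) smooth_maps(4)]
        dv_add_scaleR[OF smooth_maps(1) assms(2) smooth_maps(4)])
  show framed_G: "framed_surface U G"
    unfolding framed_surface_def
  proof (intro conjI ballI)
    show "smooth_on U G"
      unfolding G_def involute_t_def[abs_def]
      by (intro smooth_on_triple smooth_intros smooth_maps open_U assms)
    fix p assume p: "p \<in> U"
    note f = frame[OF p]
    show "(nmap G p, smap G p) \<in> Delta"
      using f unfolding Delta_def N S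
      by (simp add: norm_eq_1 sin_cos_products inner_diff_left inner_diff_right)
    show "du (xmap G) p \<bullet> nmap G p = 0" "dv (xmap G) p \<bullet> nmap G p = 0"
      using f structure_equations(4,8)[OF assms(1) p]
      by (simp_all add: dX[OF p] N inner_add_left inner_diff_left)
  qed
  interpret G: framed U G
    by unfold_locales (rule open_U framed_G)+
  show "caustic_t_cond U J (\<lambda>p. - lam p) (\<lambda>p. - \<theta> p)" if J: "basic_invariants U G J" for J
    unfolding caustic_t_cond_def
  proof (intro conjI ballI)
    fix p assume p: "p \<in> U"
    note f = frame[OF p] and J' = G.basic_invariants_eq_inner[OF J p]
    show "- (inv_a1 J p + - lam p * inv_e1 J p) * cos (- \<theta> p) + (inv_b1 J p + - lam p * inv_f1 J p) * sin (- \<theta> p) = 0"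
      "- (inv_a2 J p + - lam p * inv_e2 J p) * cos (- \<theta> p) + (inv_b2 J p + - lam p * inv_f2 J p) * sin (- \<theta> p) = 0"
      unfolding J' dX[OF p] T[OF p] N S
      using f by (simp_all add: inner_add_left inner_diff_left inner_add_right inner_diff_right algebra_simps)
  qed (intro smooth_intros open_U assms)+
  show "caustic_t (\<lambda>p. - lam p) (\<lambda>p. - \<theta> p) G p = (x p, n p, s p)" if p: "p \<in> U" for p
  proof -
    have "cos (- \<theta> p) *\<^sub>R smap G p - sin (- \<theta> p) *\<^sub>R tmap G p
        = n p"
      "sin (- \<theta> p) *\<^sub>R smap G p + cos (- \<theta> p) *\<^sub>R tmap G p
        = s p"
      unfolding T[OF p] S by (simp_all add: sin_cos_products algebra_simps)
    then show ?thesis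
      unfolding caustic_t_def by (simp add: X N)
  qed
qed

text \<open>
  The condition on \<open>lam\<close> and \<open>\<theta>\<close> is that the new normal is orthogonal to the derivatives of \<open>x + lam n\<close>.
  The first frame vector of the caustic is the old normal \<open>n\<close>, along which \<open>x\<close> and \<open>n\<close> have no
  derivative, so that only the derivative of \<open>lam\<close> is left in this component. The displacement \<open>L\<close> is arbitrary here, because
  only its integral form depends on the invariants.
\<close>

lemma framed_caustic_s:
  assumes "basic_invariants U F I" "caustic_s_cond U I lam \<theta>"
  defines "G \<equiv> caustic_s lam \<theta> F"
  shows "framed_surface U G"
    and "\<And>J p. basic_invariants U G J \<Longrightarrow> p \<in> U \<Longrightarrow> inv_a1 J p = du lam p \<and> inv_a2 J p = dv lam p"
    and "\<And>L p. p \<in> U \<Longrightarrow> involute_s L (\<lambda>p. - \<theta> p) G p = (x p + (lam p + L p) *\<^sub>R n p, n p, s p)"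
proof -
  have sm: "smooth_on U lam" "smooth_on U \<theta>"
    using assms(2) by (simp_all add: caustic_s_cond_def)
  have X: "xmap G = (\<lambda>p. x p + lam p *\<^sub>R n p)" and S: "smap G = n"
    and N: "nmap G = (\<lambda>p. sin (\<theta> p) *\<^sub>R s p + cos (\<theta> p) *\<^sub>R t p)"
    by (simp_all add: G_def caustic_s_def xmap_def nmap_def smap_def tmap_def fun_eq_iff)
  have T: "tmap G p = cos (\<theta> p) *\<^sub>R s p - sin (\<theta> p) *\<^sub>R t p" if "p \<in> U" for p
    using frame[OF that]
    by (simp add: tmap_def[of G] N S cross_add_left cross_mult_left)
  have dX: "du (xmap G) p = du x p + lam p *\<^sub>R du n p + du lam p *\<^sub>R n p"
    "dv (xmap G) p = dv x p + lam p *\<^sub>R dv n p + dv lam p *\<^sub>R n p" if "p \<in> U" for p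
    unfolding X using that
    by (simp_all add: du_add_scaleR[OF smooth_maps(1) sm(1) smooth_maps(2)]
        dv_add_scaleR[OF smooth_maps(1) sm(1) smooth_maps(2)])
  show framed_G: "framed_surface U G"
    unfolding framed_surface_def
  proof (intro conjI ballI)
    show "smooth_on U G"
      unfolding G_def caustic_s_def[abs_def]
      by (intro smooth_on_triple smooth_intros smooth_maps open_U sm)
    fix p assume p: "p \<in> U"
    note f = frame[OF p]
    show "(nmap G p, smap G p) \<in> Delta"
      using f unfolding Delta_def N S
      by (simp add: norm_eq_1 sin_cos_products inner_add_left inner_add_right)
    have "(inv_a1 I p + lam p * inv_e1 I p) * sin (\<theta> p) + (inv_b1 I p + lam p * inv_f1 I p) * cos (\<theta> p) = 0"
      "(inv_a2 I p + lam p * inv_e2 I p) * sin (\<theta> p) + (inv_b2 I p + lam p * inv_f2 I p) * cos (\<theta> p) = 0"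
      using assms(2) p by (simp_all add: caustic_s_cond_def)
    then show "du (xmap G) p \<bullet> nmap G p = 0" "dv (xmap G) p \<bullet> nmap G p = 0"
      using f unfolding dX[OF p] N structure_equations[OF assms(1) p]
      by (simp_all add: inner_add_left inner_add_right algebra_simps)
  qed
  interpret G: framed U G
    by unfold_locales (rule open_U framed_G)+
  show "inv_a1 J p = du lam p \<and> inv_a2 J p = dv lam p" if J: "basic_invariants U G J" and p: "p \<in> U" for J p
    unfolding G.basic_invariants_eq_inner[OF J p] dX[OF p] S structure_equations[OF assms(1) p]
    using frame[OF p] by (simp add: inner_add_left)
  show "involute_s L (\<lambda>p. - \<theta> p) G p = (x p + (lam p + L p) *\<^sub>R n p, n p, s p)" if p: "p \<in> U" for L p
  proof -
    have "cos (- \<theta> p) *\<^sub>R tmap G p - sin (- \<theta> p) *\<^sub>R nmap G p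
        = s p"
      unfolding T[OF p] N by (simp add: sin_cos_products algebra_simps)
    then show ?thesis
      unfolding involute_s_def by (simp add: X S algebra_simps)
  qed
qed

text \<open>
  As for \<open>framed_caustic_s\<close>, but here the old normal is the second tangent vector of the new frame, so the
  derivatives of \<open>lam\<close> appear as \<open>b\<^sub>1\<close> and \<open>b\<^sub>2\<close>.
\<close>

lemma framed_caustic_t:
  assumes "basic_invariants U F I" "caustic_t_cond U I lam \<theta>"
  defines "G \<equiv> caustic_t lam \<theta> F"
  shows "framed_surface U G"
    and "\<And>J p. basic_invariants U G J \<Longrightarrow> p \<in> U \<Longrightarrow> inv_b1 J p = du lam p \<and> inv_b2 J p = dv lam p"
    and "\<And>L p. p \<in> U \<Longrightarrow> involute_t L (\<lambda>p. - \<theta> p) G p = (x p + (lam p + L p) *\<^sub>R n p, n p, s p)"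
proof -
  have sm: "smooth_on U lam" "smooth_on U \<theta>"
    using assms(2) by (simp_all add: caustic_t_cond_def)
  have X: "xmap G = (\<lambda>p. x p + lam p *\<^sub>R n p)"
    and N: "nmap G = (\<lambda>p. cos (\<theta> p) *\<^sub>R s p - sin (\<theta> p) *\<^sub>R t p)"
    and S: "smap G = (\<lambda>p. sin (\<theta> p) *\<^sub>R s p + cos (\<theta> p) *\<^sub>R t p)"
    by (simp_all add: G_def caustic_t_def xmap_def nmap_def smap_def tmap_def fun_eq_iff)
  have T: "tmap G p = n p" if "p \<in> U" for p
    unfolding tmap_def[of G] N S Cross3.left_diff_distrib cross_add_right cross_mult_left cross_mult_right
    using frame[OF that] by (simp add: sin_cos_products algebra_simps)
  have dX: "du (xmap G) p = du x p + lam p *\<^sub>R du n p + du lam p *\<^sub>R n p"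
    "dv (xmap G) p = dv x p + lam p *\<^sub>R dv n p + dv lam p *\<^sub>R n p" if "p \<in> U" for p
    unfolding X using that
    by (simp_all add: du_add_scaleR[OF smooth_maps(1) sm(1) smooth_maps(2)]
        dv_add_scaleR[OF smooth_maps(1) sm(1) smooth_maps(2)])
  show framed_G: "framed_surface U G"
    unfolding framed_surface_def
  proof (intro conjI ballI)
    show "smooth_on U G"
      unfolding G_def caustic_t_def[abs_def]
      by (intro smooth_on_triple smooth_intros smooth_maps open_U sm)
    fix p assume p: "p \<in> U"
    note f = frame[OF p]
    show "(nmap G p, smap G p) \<in> Delta"
      using f unfolding Delta_def N S
      by (simp add: norm_eq_1 sin_cos_products inner_add_left inner_add_right inner_diff_left inner_diff_right)
    have "- (inv_a1 I p + lam p * inv_e1 I p) * cos (\<theta> p) + (inv_b1 I p + lam p * inv_f1 I p) * sin (\<theta> p) = 0"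
      "- (inv_a2 I p + lam p * inv_e2 I p) * cos (\<theta> p) + (inv_b2 I p + lam p * inv_f2 I p) * sin (\<theta> p) = 0"
      using assms(2) p by (simp_all add: caustic_t_cond_def)
    then show "du (xmap G) p \<bullet> nmap G p = 0" "dv (xmap G) p \<bullet> nmap G p = 0"
      using f unfolding dX[OF p] N structure_equations[OF assms(1) p]
      by (simp_all add: inner_add_left inner_add_right inner_diff_right algebra_simps)
  qed
  interpret G: framed U G
    by unfold_locales (rule open_U framed_G)+
  show "inv_b1 J p = du lam p \<and> inv_b2 J p = dv lam p" if J: "basic_invariants U G J" and p: "p \<in> U" for J p
    unfolding G.basic_invariants_eq_inner[OF J p] dX[OF p] T[OF p] structure_equations[OF assms(1) p]
    using frame[OF p] by (simp add: inner_add_left)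
  show "involute_t L (\<lambda>p. - \<theta> p) G p = (x p + (lam p + L p) *\<^sub>R n p, n p, s p)" if p: "p \<in> U" for L p
  proof -
    have "cos (- \<theta> p) *\<^sub>R nmap G p - sin (- \<theta> p) *\<^sub>R smap G p
        = s p"
      unfolding S N by (simp add: sin_cos_products algebra_simps)
    then show ?thesis
      unfolding involute_t_def by (simp add: X T[OF p] algebra_simps)
  qed
qed

end

lemma caustic_of_involute_s:
  assumes U: "open U" "simply_connected U" "path_choice U p0 c"
    and F: "framed_surface U F" "basic_invariants U F I"
    and "involute_s_cond U I" "smooth_on U \<theta>"
  defines "lam \<equiv> involute_s_length U p0 c I"
  defines "G \<equiv> involute_s lam \<theta> F"
  shows "framed_surface U G \<and> (\<exists>J. basic_invariants U G J) \<and>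
    (\<forall>J. basic_invariants U G J \<longrightarrow> caustic_s_cond U J (\<lambda>p. - lam p) (\<lambda>p. - \<theta> p)) \<and>
    (\<forall>p\<in>U. caustic_s (\<lambda>p. - lam p) (\<lambda>p. - \<theta> p) G p = (xmap F p, nmap F p, smap F p))"
proof -
  interpret framed U F
    by unfold_locales (rule U(1) F(1))+
  have a: "smooth_on U (inv_a1 I)" "smooth_on U (inv_a2 I)"
    using F(2) by (simp_all add: basic_invariants_def)
  have "dv (inv_a1 I) p = du (inv_a2 I) p" if "p \<in> U" for p
    using integrability(1)[OF F(2) that] assms(6) that by (simp add: involute_s_cond_def)
  note form_integral_closed[OF U a this]
  moreover have "lam = (\<lambda>p. - form_integral U p0 c (inv_a1 I) (inv_a2 I) p)"
    by (simp add: lam_def involute_s_length_def fun_eq_iff)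
  ultimately have lam: "smooth_on U lam" "\<And>p. p \<in> U \<Longrightarrow> du lam p = - inv_a1 I p"
    "\<And>p. p \<in> U \<Longrightarrow> dv lam p = - inv_a2 I p"
    by blast+
  note inv = framed_involute_s[OF F(2) lam(1) assms(7) lam(2,3), folded G_def]
  interpret G: framed U G
    by unfold_locales (rule U(1) inv(1))+
  show ?thesis
    using inv G.basic_invariants_exist by blast
qed

lemma caustic_of_involute_t:
  assumes U: "open U" "simply_connected U" "path_choice U p0 c"
    and F: "framed_surface U F" "basic_invariants U F I"
    and "involute_t_cond U I" "smooth_on U \<theta>"
  defines "lam \<equiv> involute_t_length U p0 c I"
  defines "G \<equiv> involute_t lam \<theta> F"
  shows "framed_surface U G \<and> (\<exists>J. basic_invariants U G J) \<and>
    (\<forall>J. basic_invariants U G J \<longrightarrow> caustic_t_cond U J (\<lambda>p. - lam p) (\<lambda>p. - \<theta> p)) \<and>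
    (\<forall>p\<in>U. caustic_t (\<lambda>p. - lam p) (\<lambda>p. - \<theta> p) G p = (xmap F p, nmap F p, smap F p))"
proof -
  interpret framed U F
    by unfold_locales (rule U(1) F(1))+
  have b: "smooth_on U (inv_b1 I)" "smooth_on U (inv_b2 I)"
    using F(2) by (simp_all add: basic_invariants_def)
  have "dv (inv_b1 I) p = du (inv_b2 I) p" if "p \<in> U" for p
    using integrability(2)[OF F(2) that] assms(6) that by (simp add: involute_t_cond_def)
  note form_integral_closed[OF U b this]
  moreover have "lam = (\<lambda>p. - form_integral U p0 c (inv_b1 I) (inv_b2 I) p)"
    by (simp add: lam_def involute_t_length_def fun_eq_iff)
  ultimately have lam: "smooth_on U lam" "\<And>p. p \<in> U \<Longrightarrow> du lam p = - inv_b1 I p"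
    "\<And>p. p \<in> U \<Longrightarrow> dv lam p = - inv_b2 I p"
    by blast+
  note inv = framed_involute_t[OF F(2) lam(1) assms(7) lam(2,3), folded G_def]
  interpret G: framed U G
    by unfold_locales (rule U(1) inv(1))+
  show ?thesis
    using inv G.basic_invariants_exist by blast
qed

lemma involute_of_caustic_s:
  assumes U: "open U" "path_choice U p0 c"
    and F: "framed_surface U F" "basic_invariants U F I"
    and cond: "caustic_s_cond U I lam \<theta>"
  defines "G \<equiv> caustic_s lam \<theta> F"
  shows "framed_surface U G \<and> (\<exists>J. basic_invariants U G J) \<and>
    (\<forall>J. basic_invariants U G J \<longrightarrow> involute_s_cond U J \<and>
      (\<forall>p\<in>U. involute_s (involute_s_length U p0 c J) (\<lambda>p. - \<theta> p) G p =
        (xmap F p + lam p0 *\<^sub>R nmap F p, nmap F p, smap F p)))"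
proof -
  interpret framed U F
    by unfold_locales (rule U(1) F(1))+
  note caus = framed_caustic_s[OF F(2) cond, folded G_def]
  interpret G: framed U G
    by unfold_locales (rule U(1) caus(1))+
  have lam: "smooth_on U lam"
    using cond by (simp add: caustic_s_cond_def)
  have "involute_s_cond U J \<and> (\<forall>p\<in>U. involute_s (involute_s_length U p0 c J) (\<lambda>p. - \<theta> p) G p =
      (x p + lam p0 *\<^sub>R n p, n p, s p))" if J: "basic_invariants U G J" for J
  proof
    have a: "smooth_on U (inv_a1 J)" "smooth_on U (inv_a2 J)"
      "\<And>q. q \<in> U \<Longrightarrow> inv_a1 J q = du lam q" "\<And>q. q \<in> U \<Longrightarrow> inv_a2 J q = dv lam q"
      using J caus(2)[OF J] by (simp_all add: basic_invariants_def)
    show "involute_s_cond U J"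
      unfolding involute_s_cond_def
    proof
      fix p assume p: "p \<in> U"
      have "dv (inv_a1 J) p = du (inv_a2 J) p"
        using dv_cong[OF U(1) p a(1,3)] du_cong[OF U(1) p a(2,4)] dv_du_eq_du_dv[OF U(1) lam p] by simp
      then show "inv_b1 J p * inv_g2 J p - inv_b2 J p * inv_g1 J p = 0"
        using G.integrability(1)[OF J p] by simp
    qed
    show "\<forall>p\<in>U. involute_s (involute_s_length U p0 c J) (\<lambda>p. - \<theta> p) G p = (x p + lam p0 *\<^sub>R n p, n p, s p)"
      using form_integral_gradient[OF U _ lam a(3,4)] caus(3) by (simp add: involute_s_length_def)
  qed
  then show ?thesis
    using caus(1) G.basic_invariants_exist by blast
qed

lemma involute_of_caustic_t:
  assumes U: "open U" "path_choice U p0 c"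
    and F: "framed_surface U F" "basic_invariants U F I"
    and cond: "caustic_t_cond U I lam \<theta>"
  defines "G \<equiv> caustic_t lam \<theta> F"
  shows "framed_surface U G \<and> (\<exists>J. basic_invariants U G J) \<and>
    (\<forall>J. basic_invariants U G J \<longrightarrow> involute_t_cond U J \<and>
      (\<forall>p\<in>U. involute_t (involute_t_length U p0 c J) (\<lambda>p. - \<theta> p) G p =
        (xmap F p + lam p0 *\<^sub>R nmap F p, nmap F p, smap F p)))"
proof -
  interpret framed U F
    by unfold_locales (rule U(1) F(1))+
  note caus = framed_caustic_t[OF F(2) cond, folded G_def]
  interpret G: framed U G
    by unfold_locales (rule U(1) caus(1))+
  have lam: "smooth_on U lam"
    using cond by (simp add: caustic_t_cond_def)
  have "involute_t_cond U J \<and> (\<forall>p\<in>U. involute_t (involute_t_length U p0 c J) (\<lambda>p. - \<theta> p) G p =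
      (x p + lam p0 *\<^sub>R n p, n p, s p))" if J: "basic_invariants U G J" for J
  proof
    have b: "smooth_on U (inv_b1 J)" "smooth_on U (inv_b2 J)"
      "\<And>q. q \<in> U \<Longrightarrow> inv_b1 J q = du lam q" "\<And>q. q \<in> U \<Longrightarrow> inv_b2 J q = dv lam q"
      using J caus(2)[OF J] by (simp_all add: basic_invariants_def)
    show "involute_t_cond U J"
      unfolding involute_t_cond_def
    proof
      fix p assume p: "p \<in> U"
      have "dv (inv_b1 J) p = du (inv_b2 J) p"
        using dv_cong[OF U(1) p b(1,3)] du_cong[OF U(1) p b(2,4)] dv_du_eq_du_dv[OF U(1) lam p] by simp
      then show "inv_a1 J p * inv_g2 J p - inv_a2 J p * inv_g1 J p = 0"
        using G.integrability(2)[OF J p] by simp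
    qed
    show "\<forall>p\<in>U. involute_t (involute_t_length U p0 c J) (\<lambda>p. - \<theta> p) G p = (x p + lam p0 *\<^sub>R n p, n p, s p)"
      using form_integral_gradient[OF U _ lam b(3,4)] caus(3) by (simp add: involute_t_length_def)
  qed
  then show ?thesis
    using caus(1) G.basic_invariants_exist by blast
qed

theorem theorem4p6:
  fixes U :: "(real \<times> real) set"
    and F :: triple_map
    and I :: basic_inv
    and p0 :: "real \<times> real"
    and c :: "real \<times> real \<Rightarrow> real \<Rightarrow> real \<times> real"
  assumes "open U" and "connected U" and "simply_connected U"
    and "framed_surface U F"
    and "basic_invariants U F I"
    and "p0 \<in> U"
    and "path_choice U p0 c"
  shows
    "(\<forall>\<theta>. involute_s_cond U I \<and> smooth_on U \<theta> \<longrightarrow>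
        (let lam = involute_s_length U p0 c I; G = involute_s lam \<theta> F in
           framed_surface U G \<and>
           (\<exists>J. basic_invariants U G J) \<and>
           (\<forall>J. basic_invariants U G J \<longrightarrow> caustic_s_cond U J (\<lambda>p. - lam p) (\<lambda>p. - \<theta> p)) \<and>
           (\<forall>p\<in>U. caustic_s (\<lambda>p. - lam p) (\<lambda>p. - \<theta> p) G p = (xmap F p, nmap F p, smap F p)))) \<and>
     (\<forall>\<theta>. involute_t_cond U I \<and> smooth_on U \<theta> \<longrightarrow>
        (let lam = involute_t_length U p0 c I; G = involute_t lam \<theta> F in
           framed_surface U G \<and>
           (\<exists>J. basic_invariants U G J) \<and>
           (\<forall>J. basic_invariants U G J \<longrightarrow> caustic_t_cond U J (\<lambda>p. - lam p) (\<lambda>p. - \<theta> p)) \<and>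
           (\<forall>p\<in>U. caustic_t (\<lambda>p. - lam p) (\<lambda>p. - \<theta> p) G p = (xmap F p, nmap F p, smap F p)))) \<and>
     (\<forall>lam \<theta>. caustic_s_cond U I lam \<theta> \<longrightarrow>
        (let G = caustic_s lam \<theta> F in
           framed_surface U G \<and>
           (\<exists>J. basic_invariants U G J) \<and>
           (\<forall>J. basic_invariants U G J \<longrightarrow>
              involute_s_cond U J \<and>
              (\<forall>p\<in>U. involute_s (involute_s_length U p0 c J) (\<lambda>p. - \<theta> p) G p =
                 (xmap F p + lam p0 *\<^sub>R nmap F p, nmap F p, smap F p))))) \<and>
     (\<forall>lam \<theta>. caustic_t_cond U I lam \<theta> \<longrightarrow>
        (let G = caustic_t lam \<theta> F in
           framed_surface U G \<and>
           (\<exists>J. basic_invariants U G J) \<and>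
           (\<forall>J. basic_invariants U G J \<longrightarrow>
              involute_t_cond U J \<and>
              (\<forall>p\<in>U. involute_t (involute_t_length U p0 c J) (\<lambda>p. - \<theta> p) G p =
                 (xmap F p + lam p0 *\<^sub>R nmap F p, nmap F p, smap F p)))))"
proof (intro conjI allI impI)
  note U = \<open>open U\<close> \<open>simply_connected U\<close> \<open>path_choice U p0 c\<close>
    and F = \<open>framed_surface U F\<close> \<open>basic_invariants U F I\<close>
  show "let lam = involute_s_length U p0 c I; G = involute_s lam \<theta> F in
      framed_surface U G \<and> (\<exists>J. basic_invariants U G J) \<and>
      (\<forall>J. basic_invariants U G J \<longrightarrow> caustic_s_cond U J (\<lambda>p. - lam p) (\<lambda>p. - \<theta> p)) \<and>
      (\<forall>p\<in>U. caustic_s (\<lambda>p. - lam p) (\<lambda>p. - \<theta> p) G p = (xmap F p, nmap F p, smap F p))"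
    if "involute_s_cond U I \<and> smooth_on U \<theta>" for \<theta>
    unfolding Let_def using that by (intro caustic_of_involute_s U F) blast+
  show "let lam = involute_t_length U p0 c I; G = involute_t lam \<theta> F in
      framed_surface U G \<and> (\<exists>J. basic_invariants U G J) \<and>
      (\<forall>J. basic_invariants U G J \<longrightarrow> caustic_t_cond U J (\<lambda>p. - lam p) (\<lambda>p. - \<theta> p)) \<and>
      (\<forall>p\<in>U. caustic_t (\<lambda>p. - lam p) (\<lambda>p. - \<theta> p) G p = (xmap F p, nmap F p, smap F p))"
    if "involute_t_cond U I \<and> smooth_on U \<theta>" for \<theta>
    unfolding Let_def using that by (intro caustic_of_involute_t U F) blast+
  show "let G = caustic_s lam \<theta> F in
      framed_surface U G \<and> (\<exists>J. basic_invariants U G J) \<and>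
      (\<forall>J. basic_invariants U G J \<longrightarrow> involute_s_cond U J \<and>
        (\<forall>p\<in>U. involute_s (involute_s_length U p0 c J) (\<lambda>p. - \<theta> p) G p =
          (xmap F p + lam p0 *\<^sub>R nmap F p, nmap F p, smap F p)))"
    if "caustic_s_cond U I lam \<theta>" for lam \<theta>
    unfolding Let_def by (rule involute_of_caustic_s[OF U(1,3) F that])
  show "let G = caustic_t lam \<theta> F in
      framed_surface U G \<and> (\<exists>J. basic_invariants U G J) \<and>
      (\<forall>J. basic_invariants U G J \<longrightarrow> involute_t_cond U J \<and>
        (\<forall>p\<in>U. involute_t (involute_t_length U p0 c J) (\<lambda>p. - \<theta> p) G p =
          (xmap F p + lam p0 *\<^sub>R nmap F p, nmap F p, smap F p)))"
    if "caustic_t_cond U I lam \<theta>" for lam \<theta>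
    unfolding Let_def by (rule involute_of_caustic_t[OF U(1,3) F that])
qed

end
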